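(* Let $r\ge 2$ be an integer, assume $0<p<1/r$, and set $$\kappa = p(1-p)^{r-1}\,\frac{r^r}{(r-1)^{r-1}}$$ (which satisfies $\kappa<1$) and, for $d\ge 1$, $$\mu_d:=\frac{d-\frac32\log_r d}{\log_r(1/\kappa)}.$$ Then, with probability one, $$\frac{K_d}{d}\longrightarrow\frac{1}{\log_r(1/\kappa)},\qquad d\to\infty.$$ Moreover, the sequence of random variables $(K_d-\mu_d: d\ge1)$ is tight. In addition, a subsequence of $K_d-\mu_d$ converges weakly if, and only if, the limit $a:=\lim_{d\to\infty}(\mu_d-[\mu_d])$, taken along that subsequence, exists, in which case the weak limit is $[Z+a]-a$, where $$\mathbb{P}(Z\le z)=\exp\left(-C\,\kappa^{z}\right),\qquad z\in\mathbb{R},$$ for an explicit constant $C>0$ depending only on $(p,r)$.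
   Context: Let $\mathbb{T}$ be the infinite $r$-ary tree rooted at $\rho_0$ (every node has exactly $r$ children). To each node $v\in\mathbb{T}$ is attached a random variable $X_v$, where the family $\{X_v:v\in\mathbb{T}\}$ is i.i.d. Bernoulli with $\mathbb{P}(X_v=1)=1-\mathbb{P}(X_v=0)=p\in(0,1)$. A subset $A\subset\mathbb{T}$ is open if $X_v=1$ for all $v\in A$. The generation $\mathrm{gen}(v)$ is the graph distance from $\rho_0$ to $v$ (so $\mathrm{gen}(\rho_0)=0$), and $\mathbb{T}_d=\{v\in\mathbb{T}:\mathrm{gen}(v)\le d\}$. A cluster is a connected subset of nodes (subtree) $A$ of the undirected tree $\mathbb{T}$; its size $|A|$ is its number of nodes, and its root $\rho(A)$ is the node of $A$ of minimal generation. For $d\in\mathbb{N}$, $K_d$ is the size of the largest open cluster whose root has generation at most $d$: $$K_d=\max\{|A|: A \text{ an open cluster with } \rho(A)\in\mathbb{T}_d\}$$ (equal to $0$ if there is no such cluster). $\log_r$ denotes the logarithm in base $r$, and $[x]$ denotes the integer part of $x\in\mathbb{R}$.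
   Formalization: The limit a of μ_d−[μ_d] is taken modulo 1: read in the reals, "only if" fails, since subsequences with fractional parts tending to 0 and to 1 share the weak limit [Z] and can be interleaved. C is asserted to exist depending only on (p,r), without a formula. *)

theory Defs
  imports "HOL-Probability.Probability"
begin

text \<open>
  Nodes of the infinite r-ary tree are finite words over the alphabet {0, ..., r-1}: the root is the
  empty word and the children of v are the words v @ [i] with i < r.
\<close>

definition tree :: "nat \<Rightarrow> nat list set" where
  "tree r = {v. set v \<subseteq> {..<r}}"

definition child_rel :: "nat \<Rightarrow> (nat list \<times> nat list) set" where
  "child_rel r = {(v, v @ [i]) | v i. v \<in> tree r \<and> i < r}"

definition edges :: "nat \<Rightarrow> (nat list \<times> nat list) set" where
  "edges r = child_rel r \<union> (child_rel r)\<inverse>"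

definition gen :: "nat \<Rightarrow> nat list \<Rightarrow> nat" where
  "gen r v = (LEAST n. ([], v) \<in> edges r ^^ n)"

definition tree_upto :: "nat \<Rightarrow> nat \<Rightarrow> nat list set" where
  "tree_upto r d = {v \<in> tree r. gen r v \<le> d}"

definition cluster :: "nat \<Rightarrow> nat list set \<Rightarrow> bool" where
  "cluster r A \<longleftrightarrow> A \<subseteq> tree r \<and> A \<noteq> {} \<and> (\<forall>u\<in>A. \<forall>v\<in>A. (u, v) \<in> (Restr (edges r) A)\<^sup>*)"

definition cluster_root :: "nat \<Rightarrow> nat list set \<Rightarrow> nat list" where
  "cluster_root r A = arg_min (gen r) (\<lambda>v. v \<in> A)"

definition open_set :: "(nat list \<Rightarrow> 'a \<Rightarrow> bool) \<Rightarrow> 'a \<Rightarrow> nat list set \<Rightarrow> bool" where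
  "open_set X \<omega> A \<longleftrightarrow> (\<forall>v\<in>A. X v \<omega>)"

definition cluster_sizes :: "nat \<Rightarrow> (nat list \<Rightarrow> 'a \<Rightarrow> bool) \<Rightarrow> nat \<Rightarrow> 'a \<Rightarrow> nat set" where
  "cluster_sizes r X d \<omega> =
     card ` {A. cluster r A \<and> open_set X \<omega> A \<and> cluster_root r A \<in> tree_upto r d}"

text \<open>
  An infinite open cluster contains finite open clusters of every size with the same root, so it
  makes the set of sizes infinite and the maximum an unspecified constant.  A sequence that is
  eventually constant is o(d), so almost sure convergence of largest_cluster r X d / d to a
  positive limit forces the maximum to be a genuine one, for all d, almost surely.
\<close>

definition largest_cluster :: "nat \<Rightarrow> (nat list \<Rightarrow> 'a \<Rightarrow> bool) \<Rightarrow> nat \<Rightarrow> 'a \<Rightarrow> nat" where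
  "largest_cluster r X d \<omega> =
     (if cluster_sizes r X d \<omega> = {} then 0 else Max (cluster_sizes r X d \<omega>))"

definition iid_bernoulli_tree ::
    "nat \<Rightarrow> real \<Rightarrow> 'a measure \<Rightarrow> (nat list \<Rightarrow> 'a \<Rightarrow> bool) \<Rightarrow> bool" where
  "iid_bernoulli_tree r p M X \<longleftrightarrow>
     prob_space M \<and>
     prob_space.indep_vars M (\<lambda>_. count_space UNIV) X (tree r) \<and>
     (\<forall>v\<in>tree r. distr M (count_space UNIV) (X v) = measure_pmf (bernoulli_pmf p))"

definition kappa :: "nat \<Rightarrow> real \<Rightarrow> real" where
  "kappa r p = p * (1 - p) ^ (r - 1) * (real r ^ r / (real r - 1) ^ (r - 1))"

definition mu :: "nat \<Rightarrow> real \<Rightarrow> nat \<Rightarrow> real" where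
  "mu r p d = (real d - 3 / 2 * log (real r) (real d)) / log (real r) (1 / kappa r p)"

definition centered_law ::
    "nat \<Rightarrow> real \<Rightarrow> 'a measure \<Rightarrow> (nat list \<Rightarrow> 'a \<Rightarrow> bool) \<Rightarrow> nat \<Rightarrow> real measure" where
  "centered_law r p M X d =
     distr M borel (\<lambda>\<omega>. real (largest_cluster r X d \<omega>) - mu r p d)"

definition lattice_law :: "real measure \<Rightarrow> real \<Rightarrow> real measure" where
  "lattice_law Z a = distr Z borel (\<lambda>z. real_of_int \<lfloor>z + a\<rfloor> - a)"

text \<open>
  Convergence in the circle of reals modulo 1 (distance to the nearest integer).  It is the
  appropriate notion for fractional parts whose limit enters only through lattice_law, which is
  1-periodic in a: fractional parts tending to 0 and to 1 give the same lattice law, so a sequence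
  of fractional parts that accumulates exactly at 0 and 1 must be admitted as convergent.  Away from
  these two identified endpoints it is ordinary convergence of the fractional parts.
\<close>

definition tendsto_mod1 :: "(nat \<Rightarrow> real) \<Rightarrow> real \<Rightarrow> bool" where
  "tendsto_mod1 x a \<longleftrightarrow> (\<lambda>k. \<bar>(x k - a) - of_int (round (x k - a))\<bar>) \<longlonglongrightarrow> 0"

lemma relpow_edges_length: "(u, v) \<in> edges r ^^ n \<Longrightarrow> length v \<le> length u + n"
proof (induction n arbitrary: v)
  case (Suc n)
  then obtain w where w: "(u, w) \<in> edges r ^^ n" "(w, v) \<in> edges r" by auto
  then have "length v \<le> Suc (length w)" by (auto simp: edges_def child_rel_def)
  with Suc.IH[OF w(1)] show ?case by simp
qed simp

lemma relpow_edges_root: "v \<in> tree r \<Longrightarrow> ([], v) \<in> edges r ^^ length v"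
proof (induction v rule: rev_induct)
  case (snoc i v)
  then have "v \<in> tree r" "i < r" by (auto simp: tree_def)
  then have "(v, v @ [i]) \<in> edges r" by (auto simp: edges_def child_rel_def)
  with snoc.IH[OF \<open>v \<in> tree r\<close>] show ?case by auto
qed simp

lemma gen_eq_length: "v \<in> tree r \<Longrightarrow> gen r v = length v"
  unfolding gen_def using relpow_edges_length[of "[]" v]
  by (intro Least_equality relpow_edges_root) fastforce+

lemma cluster_root_minimal:
  assumes "cluster r A"
  shows "cluster_root r A \<in> A" "\<And>v. v \<in> A \<Longrightarrow> gen r (cluster_root r A) \<le> gen r v"
proof -
  from assms obtain u where "u \<in> A" by (auto simp: cluster_def)
  from arg_min_nat_lemma[of "\<lambda>v. v \<in> A", OF this, of "gen r"]
  show "cluster_root r A \<in> A" "\<And>v. v \<in> A \<Longrightarrow> gen r (cluster_root r A) \<le> gen r v"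
    by (auto simp: cluster_root_def)
qed

lemma lattice_law_periodic: "lattice_law Z (a + of_int n) = lattice_law Z a"
proof -
  have "real_of_int \<lfloor>z + (a + of_int n)\<rfloor> - (a + of_int n) = real_of_int \<lfloor>z + a\<rfloor> - a" for z :: real
  proof -
    have "\<lfloor>z + (a + of_int n)\<rfloor> = \<lfloor>z + a\<rfloor> + n"
      using floor_add_int[of "z + a" n] by (simp only: add.assoc)
    then show ?thesis by simp
  qed
  then show ?thesis unfolding lattice_law_def by (simp only:)
qed

lemma tendsto_mod1I:
  assumes "x \<longlonglongrightarrow> a"
  shows "tendsto_mod1 x a"
proof -
  have lim: "(\<lambda>k. \<bar>x k - a\<bar>) \<longlonglongrightarrow> 0"
    using assms by (rule tendsto_rabs_zero[OF LIM_zero])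
  have le: "\<bar>(x k - a) - of_int (round (x k - a))\<bar> \<le> \<bar>x k - a\<bar>" for k
    using round_diff_minimal[of "x k - a" 0] by simp
  show ?thesis
    unfolding tendsto_mod1_def
    by (rule tendsto_sandwich[OF _ _ tendsto_const lim])
       (rule always_eventually, rule allI, rule abs_ge_zero,
        rule always_eventually, rule allI, rule le)
qed

lemma tendsto_mod1_iff_tendsto:
  assumes a: "0 < a" "a < 1" and x: "\<And>k. 0 \<le> x k" "\<And>k. x k < 1"
  shows "tendsto_mod1 x a \<longleftrightarrow> x \<longlonglongrightarrow> a"
proof
  assume "tendsto_mod1 x a"
  then have lim: "(\<lambda>k. \<bar>(x k - a) - of_int (round (x k - a))\<bar>) \<longlonglongrightarrow> 0"
    by (simp add: tendsto_mod1_def)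
  have "0 < min a (1 - a)" using a by simp
  from order_tendstoD(2)[OF lim this]
  have "\<forall>\<^sub>F k in sequentially. \<bar>(x k - a) - of_int (round (x k - a))\<bar> = \<bar>x k - a\<bar>"
  proof eventually_elim
    case (elim k)
    have "-1 < real_of_int (round (x k - a))" "real_of_int (round (x k - a)) < 1"
      using elim x[of k] by linarith+
    then have "round (x k - a) = 0" by linarith
    then show ?case by simp
  qed
  from Lim_transform_eventually[OF lim this] have "(\<lambda>k. x k - a) \<longlonglongrightarrow> 0"
    by (simp add: tendsto_rabs_zero_iff)
  then show "x \<longlonglongrightarrow> a" by (rule LIM_zero_cancel)
qed (rule tendsto_mod1I)

end

theory Submission
  imports Defs "HOL-Real_Asymp.Real_Asymp" "HOL-Library.Sublist"
begin

text \<open>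
  The cluster below a fixed node has the total progeny law of a subcritical branching process with
  binomial offspring. Its generating function satisfies $G = (1-p) + p X G^r$, which is solved
  coefficientwise by checking the recursion of $G^k$ in $n$ and $k$; Stirling's formula then gives a
  tail $q_n \sim c\, n^{-3/2} \kappa^n$.

  Call a node good if its cluster has more than n nodes and its parent is closed; the largest
  cluster has more than n nodes iff there is a good node (or the root is large). Cut the tree at
  generation $d - \lfloor d/2 \rfloor$. The blocks below that generation are independent, a union
  bound handles the nodes above it, and inside a block the first two Bonferroni inequalities show
  that the probability of a good node is the expected number of good nodes up to a negligible error,
  since two distinct nodes are good with probability at most $q_n^2$. Hence
  $P(K_d \le n) = \exp(-C_0 \kappa^{n - \mu_d}) + o(1)$ as long as $n - \mu_d$ stays bounded, which
  yields tightness and the weak limits. The almost sure limit follows from Borel--Cantelli, using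
  the independence of the clusters below the nodes of generation d for the lower bound.
\<close>

section \<open>Total progeny of a binomial branching process\<close>

text \<open>If a node is large, so is every ancestor joined to it by open nodes, so counting all
  large nodes would count one cluster many times. A closed parent singles out the top of each such
  run. It costs the factor 1-p and decouples two such nodes even when one lies below the other.

  For n near mu_d the tail q_n has order r^(-d). Over the whole tree the first and second Bonferroni
  terms are then both of order one, and no limit can be read off. In a block of depth m the
  second-order term is r^(2m) q_n^2, and the r^(d-m) blocks together contribute order r^(-(d-m));
  the nodes above the cut cost r^(d-m) q_n, of order r^(-m). Both vanish once m and d-m tend to
  infinity, and halving is one such choice.

  The centering solves r^d d^(-3/2) kappa^(mu_d) = 1; the factor n^(-3/2) of the tail turns into a
  constant times d^(-3/2), since the relevant n are asymptotically proportional to d. As K_d is an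
  integer, the values of K_d - mu_d lie on a lattice that moves with the fractional part of mu_d.
  The final constant is C_0/kappa, because [Z+a]-a \<le> z means Z < [z+a]+1-a.\<close>

lemma fps_power_coeff_of_fixed_point:
  fixes G :: "real fps" and p :: real
  assumes r: "1 \<le> r"
    and G: "G = fps_const (1 - p) + fps_const p * fps_X * G ^ r"
  shows "real (k + r * n) * fps_nth (G ^ k) n
    = real k * real ((k + r * n) choose n) * p ^ n * (1 - p) ^ (k + (r - 1) * n)"
proof (induction n arbitrary: k)
  case 0
  have "fps_nth G 0 = 1 - p"
    by (subst G) simp
  then show ?case
    by (simp add: fps_power_zeroth)
next
  case (Suc m)
  \<comment> \<open>The coefficient n of \<open>G ^ (k + 1)\<close> is reached from index n at
    exponent k and from index n - 1 at exponent \<open>k + r\<close>. Hence the outer hypothesis is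
    kept for all exponents and a second induction runs over k.\<close>
  note Suc_m = Suc.IH
  show ?case
  proof (induction k)
    case 0
    then show ?case by simp
  next
    case (Suc k)
    define N where "N = k + r * Suc m"
    define c1 where "c1 = real (N choose Suc m)"
    define c2 where "c2 = real (N choose m)"
    define T where "T = p ^ Suc m * (1 - p) ^ (Suc k + (r - 1) * Suc m)"
    have "G ^ Suc k = fps_const (1 - p) * G ^ k + fps_const p * fps_X * G ^ (k + r)"
    proof -
      have "G ^ Suc k = (fps_const (1 - p) + fps_const p * fps_X * G ^ r) * G ^ k"
        by (metis G power_Suc)
      then show ?thesis
        by (simp add: algebra_simps power_add)
    qed
    then have A: "fps_nth (G ^ Suc k) (Suc m) = (1 - p) * fps_nth (G ^ k) (Suc m) + p * fps_nth (G ^ (k + r)) m"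
      by (simp add: mult.assoc)
    have I1: "real N * ((1 - p) * fps_nth (G ^ k) (Suc m)) = real k * c1 * T"
    proof -
      have "real N * fps_nth (G ^ k) (Suc m) = real k * c1 * p ^ Suc m * (1 - p) ^ (k + (r - 1) * Suc m)"
        using Suc.IH unfolding N_def c1_def .
      then have "(1 - p) * (real N * fps_nth (G ^ k) (Suc m)) = real k * c1 * T"
        by (simp add: T_def)
      then show ?thesis
        by (simp add: mult_ac)
    qed
    have "k + r + r * m = N" "k + r + (r - 1) * m = Suc k + (r - 1) * Suc m"
      using r by (cases r; simp add: N_def algebra_simps)+
    then have "real N * fps_nth (G ^ (k + r)) m
        = real (k + r) * c2 * p ^ m * (1 - p) ^ (Suc k + (r - 1) * Suc m)"
      using Suc_m[of "k + r"] unfolding c2_def by (simp add: add.assoc)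
    then have "p * (real N * fps_nth (G ^ (k + r)) m) = real (k + r) * c2 * T"
      by (simp add: T_def)
    then have I2: "real N * (p * fps_nth (G ^ (k + r)) m) = real (k + r) * c2 * T"
      by (simp add: mult_ac)
    have pascal: "real ((Suc k + r * Suc m) choose Suc m) = c1 + c2"
      by (simp add: N_def c1_def c2_def)
    have "m \<le> N"
      using r by (simp add: N_def trans_le_add2)
    have c12: "(real m + 1) * c1 = (real N - real m) * c2"
    proof -
      have "Suc m * (N choose Suc m) = (N - m) * (N choose m)"
        by (metis binomial_absorb_comp binomial_absorption mult.commute)
      then have "real (Suc m) * c1 = real (N - m) * c2"
        unfolding c1_def c2_def by (metis of_nat_mult)
      then show ?thesis
        using \<open>m \<le> N\<close> by (simp add: of_nat_diff add.commute)
    qed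
    have NR: "real N = real k + real r * (real m + 1)"
      by (simp add: N_def algebra_simps)
    \<comment> \<open>After the common powers of p and 1-p are removed, the claim is this relation
      between neighbouring binomials; it follows from the absorption identity \<open>c12\<close>
      alone.\<close>
    have key: "(real N + 1) * (real k * c1 + (real k + real r) * c2) = real N * (real k + 1) * (c1 + c2)"
      using c12 unfolding NR by algebra
    \<comment> \<open>The factor N makes both induction hypotheses applicable. It is positive since
      r \<ge> 1, and is cancelled at the end.\<close>
    have "real N * ((real N + 1) * fps_nth (G ^ Suc k) (Suc m))
        = (real N + 1) * (real N * ((1 - p) * fps_nth (G ^ k) (Suc m)) + real N * (p * fps_nth (G ^ (k + r)) m))"
      unfolding A by (simp add: algebra_simps)
    also have "\<dots> = (real N + 1) * (real k * c1 + (real k + real r) * c2) * T"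
      unfolding I1 I2 by (simp add: algebra_simps)
    also have "\<dots> = real N * ((real k + 1) * (c1 + c2) * T)"
      unfolding key by (simp add: algebra_simps)
    finally have "(real N + 1) * fps_nth (G ^ Suc k) (Suc m) = (real k + 1) * (c1 + c2) * T"
      using r by (auto simp: N_def simp del: of_nat_add of_nat_mult)
    then show ?case
      unfolding pascal T_def N_def by (simp add: algebra_simps)
  qed
qed

section \<open>The decay rate kappa\<close>

lemma kappa_pos:
  assumes "2 \<le> r" "0 < p" "p < 1"
  shows "0 < kappa r p"
  using assms by (auto simp: kappa_def intro!: mult_pos_pos divide_pos_pos)

lemma ln_kappa:
  assumes "2 \<le> r" "0 < p" "p < 1"
  shows "ln (kappa r p) = ln p + (real r - 1) * ln (1 - p) + real r * ln (real r) - (real r - 1) * ln (real r - 1)"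
proof -
  have "0 < real r - 1" "0 < real r" "0 < 1 - p"
    using assms by auto
  then show ?thesis
    using assms by (simp add: kappa_def ln_mult ln_div ln_realpow of_nat_diff)
qed

text \<open>Weighted AM-GM in logarithmic form: \<open>kappa\<close> is the product of rp and of r-1
  copies of r(1-p)/(r-1), and these r numbers have sum r. The inequality is strict because rp is not
  1.\<close>

lemma kappa_less_1:
  assumes r: "2 \<le> r" and p: "0 < p" "p < 1 / real r"
  shows "kappa r p < 1"
proof -
  have rp: "real r * p < 1"
    using r p by (simp add: field_simps)
  have "1 / real r \<le> 1" using r by simp
  then have p1: "p < 1" using p by linarith
  have s: "0 < real r - 1" using r by simp
  define y where "y = real r * (1 - p) / (real r - 1)"
  have ln1: "ln (real r * p) < real r * p - 1"
    using ln_le_minus_one[of "real r * p"] ln_eq_minus_one[of "real r * p"] rp r p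
    by (fastforce simp: less_le)
  have ypos: "0 < y"
    using s p1 r by (simp add: y_def)
  have "(real r - 1) * ln y \<le> (real r - 1) * (y - 1)"
    using ln_le_minus_one[OF ypos] s by (intro mult_left_mono) auto
  also have "\<dots> = 1 - real r * p"
    using s by (simp add: y_def field_simps)
  finally have "ln (real r * p) + (real r - 1) * ln y < 0"
    using ln1 by linarith
  moreover have "ln (kappa r p) = ln (real r * p) + (real r - 1) * ln y"
  proof -
    have *: "ln (real r * p) = ln (real r) + ln p" "ln y = ln (real r) + ln (1 - p) - ln (real r - 1)"
      using s p1 p r by (simp_all add: y_def ln_mult ln_div)
    then show ?thesis
      unfolding ln_kappa[OF r p(1) p1] * by (simp add: algebra_simps)
  qed
  ultimately have "ln (kappa r p) < 0"
    by simp
  then show ?thesis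
    using kappa_pos[OF r p(1) p1] by simp
qed

section \<open>Stirling asymptotics of the size law and of its tail\<close>

lemma ln_fact_asymp:
  "convergent (\<lambda>n. ln (fact n) - ((real n + 1 / 2) * ln (real n) - real n))"
proof -
  define f where "f = (\<lambda>n. ln (fact n) - ((real n + 1 / 2) * ln (real n) - real n))"
  \<comment> \<open>Stirling's formula up to its constant: the increments are of order 1/n^2. The
    value of the limit is left open, since it is only absorbed into later constants.\<close>
  have "summable (\<lambda>n. f (Suc n) - f n)"
  proof (rule summable_comparison_test_bigo)
    show "summable (\<lambda>n. norm (1 / real n ^ 2))"
      using inverse_power_summable[of 2, where ?'a = real] by (simp add: field_simps)
    have "(\<lambda>n. ln (real n + 1) - ((real n + 1 + 1 / 2) * ln (real n + 1) - (real n + 1))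
        + ((real n + 1 / 2) * ln (real n) - real n)) \<in> O(\<lambda>n. 1 / real n ^ 2)"
      by real_asymp
    also have "(\<lambda>n. ln (real n + 1) - ((real n + 1 + 1 / 2) * ln (real n + 1) - (real n + 1))
        + ((real n + 1 / 2) * ln (real n) - real n)) = (\<lambda>n. f (Suc n) - f n)"
    proof
      fix n :: nat
      have "ln (fact (Suc n) :: real) = ln (real n + 1) + ln (fact n)"
        by (simp add: ln_mult add.commute)
      then show "ln (real n + 1) - ((real n + 1 + 1 / 2) * ln (real n + 1) - (real n + 1))
        + ((real n + 1 / 2) * ln (real n) - real n) = f (Suc n) - f n"
        unfolding f_def by (simp add: algebra_simps)
    qed
    finally show "(\<lambda>n. f (Suc n) - f n) \<in> O(\<lambda>n. 1 / real n ^ 2)" .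
  qed
  then have "convergent (\<lambda>n. \<Sum>i<n. f (Suc i) - f i)"
    by (simp add: summable_iff_convergent)
  then have "convergent (\<lambda>n. f n - f 0)"
    by (simp add: sum_lessThan_telescope)
  then have "convergent (\<lambda>n. f n - f 0 + f 0)"
    by (intro convergent_add convergent_const)
  then show ?thesis
    by (simp add: f_def)
qed

text \<open>The case k = 1 of the coefficient formula. The quotient is the Fuss-Catalan number of
  r-ary trees with n nodes; such a cluster has n open nodes and 1 + (r-1)n closed boundary
  nodes.\<close>

definition size_prob :: "nat \<Rightarrow> real \<Rightarrow> nat \<Rightarrow> real" where
  "size_prob r p n = real ((1 + r * n) choose n) / real (1 + r * n) * p ^ n * (1 - p) ^ (1 + (r - 1) * n)"

lemma size_prob_pos:
  assumes "1 \<le> r" "0 < p" "p < 1"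
  shows "0 < size_prob r p n"
proof -
  have "n \<le> 1 + r * n"
    using assms(1) by (cases r) auto
  then have "0 < (1 + r * n) choose n"
    by (simp add: zero_less_binomial_iff)
  then have "0 < real ((1 + r * n) choose n)"
    by (simp only: of_nat_0_less_iff)
  moreover have "0 < real (1 + r * n)"
    by (simp only: of_nat_0_less_iff)
  ultimately show ?thesis
    using assms unfolding size_prob_def
    by (intro mult_pos_pos divide_pos_pos zero_less_power; (assumption | simp))
qed

lemma size_prob_asymp:
  assumes r: "2 \<le> r" and p: "0 < p" "p < 1"
  obtains c where "0 < c"
    "(\<lambda>n. size_prob r p n / (real n powr (- 3 / 2) * kappa r p ^ n)) \<longlonglongrightarrow> c"
proof -
  define f where "f = (\<lambda>n. ln (fact n) - ((real n + 1 / 2) * ln (real n) - real n))"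
  obtain L where L: "f \<longlonglongrightarrow> L"
    using ln_fact_asymp by (auto simp: f_def convergent_def)
  define s where "s = r - 1"
  have s: "0 < s" "real r = real s + 1" "r = Suc s"
    using r by (auto simp: s_def)
  have Lr: "(\<lambda>n. f (r * n)) \<longlonglongrightarrow> L"
    by (rule LIMSEQ_subseq_LIMSEQ[OF L, unfolded o_def]) (use r in \<open>auto simp: strict_mono_def\<close>)
  have Ls: "(\<lambda>n. f (s * n)) \<longlonglongrightarrow> L"
    by (rule LIMSEQ_subseq_LIMSEQ[OF L, unfolded o_def]) (use s in \<open>auto simp: strict_mono_def\<close>)
  \<comment> \<open>What is left of the logarithm of the normalised probability once Stirling's main
    terms cancel. The last summand comes from 1 + sn = n(s + 1/n).\<close>
  define g where "g = (\<lambda>n. f (r * n) - f n - f (s * n)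
      + (ln (real r) / 2 - ln (real s) / 2 + ln (1 - p)) - ln (real s + 1 / real n))"
  have lnlim: "(\<lambda>n. ln (real s + 1 / real n)) \<longlonglongrightarrow> ln (real s)"
    using s(1) by real_asymp
  have g: "g \<longlonglongrightarrow> L - L - L + (ln (real r) / 2 - ln (real s) / 2 + ln (1 - p)) - ln (real s)"
    unfolding g_def by (intro tendsto_add tendsto_diff tendsto_const L Lr Ls lnlim)
  have eq: "exp (g n) = size_prob r p n / (real n powr (- 3 / 2) * kappa r p ^ n)" if n: "0 < n" for n
  proof -
    have n0: "0 < real n" "0 < real s" "0 < real r" "0 < 1 - p" "0 < kappa r p"
      using n s p r kappa_pos[of r p] by auto
    have ch: "real ((1 + r * n) choose n) = fact (1 + r * n) / (fact n * fact (1 + s * n))"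
    proof -
      have "1 + r * n - n = 1 + s * n" "n \<le> 1 + r * n"
        unfolding s(3) by auto
      then show ?thesis
        using binomial_fact[of n "1 + r * n", where ?'a = real] by simp
    qed
    have "fact (1 + r * n) = real (1 + r * n) * fact (r * n)"
         "fact (1 + s * n) = real (1 + s * n) * fact (s * n)"
      by simp_all
    then have sp: "size_prob r p n = fact (r * n) / (fact n * (real (1 + s * n) * fact (s * n))) * p ^ n * (1 - p) ^ (1 + s * n)"
      unfolding size_prob_def ch s_def[symmetric]
      using add_pos_nonneg[of 1 "real r * real n"] by simp
    have "ln (size_prob r p n) = ln (fact (r * n)) - ln (fact n) - ln (real (1 + s * n)) - ln (fact (s * n))
       + real n * ln p + real (1 + s * n) * ln (1 - p)"
      unfolding sp using p add_pos_nonneg[of 1 "real s * real n"]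
      by (simp add: ln_mult ln_div ln_realpow) (simp add: distrib_right)
    also have "ln (real (1 + s * n)) = ln (real n) + ln (real s + 1 / real n)"
    proof -
      have "real (1 + s * n) = real n * (real s + 1 / real n)"
        using n0 by (simp add: field_simps)
      moreover have "0 < real s + 1 / real n"
        using n0 by (simp add: add_pos_pos)
      ultimately show ?thesis
        using n0 by (simp add: ln_mult)
    qed
    finally have lns: "ln (size_prob r p n) = ln (fact (r * n)) - ln (fact n) - (ln (real n) + ln (real s + 1 / real n)) - ln (fact (s * n))
       + real n * ln p + real (1 + s * n) * ln (1 - p)" .
    have ff: "ln (fact m) = f m + ((real m + 1 / 2) * ln (real m) - real m)" for m
      by (simp add: f_def)
    have lnrn: "ln (real (r * n)) = ln (real r) + ln (real n)" "ln (real (s * n)) = ln (real s) + ln (real n)"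
      using n0 by (simp_all add: ln_mult)
    have rn: "real (r * n) = (real s + 1) * real n" "real (s * n) = real s * real n" "real (1 + s * n) = 1 + real s * real n"
      using s(2) by (simp_all add: algebra_simps)
    \<comment> \<open>The terms n ln n cancel because r = s + 1, the coefficients of ln n add up to
      1/2 - 1/2 - 1/2 - 1 = -3/2, and the linear terms combine to n ln kappa.\<close>
    have "ln (size_prob r p n) - (- 3 / 2 * ln (real n) + real n * ln (kappa r p)) = g n"
      unfolding lns ff lnrn unfolding ln_kappa[OF r p] g_def rn s(2) by (simp add: field_simps)
    moreover have "ln (size_prob r p n / (real n powr (- 3 / 2) * kappa r p ^ n))
        = ln (size_prob r p n) - (- 3 / 2 * ln (real n) + real n * ln (kappa r p))"
      using n0 size_prob_pos[of r p n] r p by (simp add: ln_div ln_mult ln_powr ln_realpow)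
    ultimately show ?thesis
      using n0 size_prob_pos[of r p n] r p by (metis divide_pos_pos exp_ln mult_pos_pos powr_gt_zero zero_less_power less_imp_neq
          One_nat_def Suc_leD numeral_2_eq_2)
  qed
  show ?thesis
  proof
    show "0 < exp (L - L - L + (ln (real r) / 2 - ln (real s) / 2 + ln (1 - p)) - ln (real s))"
      by simp
    show "(\<lambda>n. size_prob r p n / (real n powr (- 3 / 2) * kappa r p ^ n))
        \<longlonglongrightarrow> exp (L - L - L + (ln (real r) / 2 - ln (real s) / 2 + ln (1 - p)) - ln (real s))"
      by (rule Lim_transform_eventually[OF tendsto_exp[OF g]])
        (use eq in \<open>auto intro!: eventually_mono[OF eventually_gt_at_top[of 0]]\<close>)
  qed
qed

text \<open>Up to the polynomial factor the terms are geometric: the normalised tail is a series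
  whose j-th term tends to c k^(j+1). A geometric bound uniform in n lets Tannery's theorem exchange
  limit and sum.\<close>

lemma tail_asymp:
  fixes s :: "nat \<Rightarrow> real"
  assumes k: "0 < k" "k < 1"
    and lim: "(\<lambda>n. s n / (real n powr (- 3 / 2) * k ^ n)) \<longlonglongrightarrow> c"
    and sums: "s sums t"
  shows "(\<lambda>n. (t - (\<Sum>i\<le>n. s i)) / (real n powr (- 3 / 2) * k ^ n)) \<longlonglongrightarrow> c * k / (1 - k)"
proof -
  define a where "a = (\<lambda>j n. s (j + Suc n) / (real n powr (- 3 / 2) * k ^ n))"
  have lim_j: "(\<lambda>n. a j n) \<longlonglongrightarrow> c * k ^ Suc j" for j
  proof -
    have 1: "(\<lambda>n. s (n + Suc j) / (real (n + Suc j) powr (- 3 / 2) * k ^ (n + Suc j))) \<longlonglongrightarrow> c"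
      using LIMSEQ_ignore_initial_segment[OF lim] .
    have 2: "(\<lambda>n. (real n + real (Suc j)) powr (- 3 / 2) / real n powr (- 3 / 2)) \<longlonglongrightarrow> 1"
      by real_asymp
    have "(\<lambda>n. s (n + Suc j) / (real (n + Suc j) powr (- 3 / 2) * k ^ (n + Suc j)) * k ^ Suc j *
        ((real n + real (Suc j)) powr (- 3 / 2) / real n powr (- 3 / 2))) \<longlonglongrightarrow> c * k ^ Suc j * 1"
      by (intro tendsto_mult 1 2 tendsto_const)
    moreover have "\<forall>\<^sub>F n in sequentially. s (n + Suc j) / (real (n + Suc j) powr (- 3 / 2) * k ^ (n + Suc j)) * k ^ Suc j *
        ((real n + real (Suc j)) powr (- 3 / 2) / real n powr (- 3 / 2)) = a j n"
      using eventually_gt_at_top[of 0]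
    proof eventually_elim
      case (elim n)
      define z where "z = (real n + real (Suc j)) powr (- 3 / 2)"
      have "0 < z" by (simp add: z_def)
      moreover have "real (n + Suc j) powr (- 3 / 2) = z" "j + Suc n = n + Suc j"
        by (simp_all add: z_def add_ac)
      ultimately show ?case
        using k elim unfolding a_def z_def[symmetric] by (simp add: power_add mult_ac add_ac)
    qed
    ultimately show ?thesis
      using Lim_transform_eventually by fastforce
  qed
  obtain K0 where K0: "\<And>n. norm (s n / (real n powr (- 3 / 2) * k ^ n)) \<le> K0"
    using convergent_imp_Bseq[OF convergentI[OF lim]] by (meson BseqE)
  have "0 \<le> K0" using K0[of 0] norm_ge_zero order_trans by blast
  \<comment> \<open>The ratio of the polynomial factors is at most 1 because n^(-3/2) decreases. The
    index 0 is left out, as \<open>0 powr (- 3 / 2)\<close> is 0 and the quotient degenerates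
    there.\<close>
  have bnd: "norm (a j n) \<le> K0 * k ^ Suc j" if "0 < n" for j n
  proof -
    have "norm (a j n) = norm (s (j + Suc n) / (real (j + Suc n) powr (- 3 / 2) * k ^ (j + Suc n))) * k ^ Suc j *
        (real (j + Suc n) powr (- 3 / 2) / real n powr (- 3 / 2))"
      using k that by (simp add: a_def power_add field_simps abs_mult)
    also have "\<dots> \<le> K0 * k ^ Suc j * 1"
    proof (intro mult_mono mult_nonneg_nonneg)
      show "real (j + Suc n) powr (- 3 / 2) / real n powr (- 3 / 2) \<le> 1"
        using that powr_mono2'[of "-3/2" "real n" "real (j + Suc n)"] by simp
    qed (use K0[of "j + Suc n"] \<open>0 \<le> K0\<close> k in auto)
    finally show ?thesis by simp
  qed
  have "((\<lambda>n. \<Sum>j. a j n) \<longlongrightarrow> (\<Sum>j. c * k ^ Suc j)) sequentially"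
  proof (rule tannerys_theorem[THEN conjunct2, THEN conjunct2, OF lim_j])
    show "\<forall>\<^sub>F (j, n) in at_top \<times>\<^sub>F sequentially. norm (a j n) \<le> K0 * k ^ Suc j"
      unfolding eventually_prod_filter
      by (rule exI[of _ "\<lambda>_. True"], rule exI[of _ "\<lambda>n. 0 < n"])
        (use bnd eventually_gt_at_top[of 0] in auto)
    show "summable (\<lambda>j. K0 * k ^ Suc j)"
      using k by (intro summable_mult) (simp add: summable_geometric)
  qed simp
  moreover have "(\<Sum>j. c * k ^ Suc j) = c * k / (1 - k)"
  proof -
    have "(\<lambda>j. (c * k) * k ^ j) sums ((c * k) * (1 / (1 - k)))"
      using k by (intro sums_mult geometric_sums) auto
    then show ?thesis
      by (simp add: sums_iff mult_ac)
  qed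
  moreover have "(\<Sum>j. a j n) = (t - (\<Sum>i\<le>n. s i)) / (real n powr (- 3 / 2) * k ^ n)" for n
  proof -
    have "(\<lambda>j. s (j + Suc n)) sums (t - (\<Sum>i\<le>n. s i))"
      using sums_split_initial_segment[OF sums, of "Suc n"] by (simp add: lessThan_Suc_atMost)
    from sums_divide[OF this, of "real n powr (- 3 / 2) * k ^ n"]
    show ?thesis by (simp add: a_def sums_iff)
  qed
  ultimately show ?thesis by simp
qed

section \<open>Clusters as prefix-closed sets of words\<close>

definition subtree :: "nat list \<Rightarrow> (nat list \<Rightarrow> bool) \<Rightarrow> nat list \<Rightarrow> bool" where
  "subtree v x = (\<lambda>w. x (v @ w))"

text \<open>Closing everything outside K keeps configurations total functions on all words. It
  serves both to forget words outside the tree and to express that an event depends only on the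
  nodes of K.\<close>

definition mask :: "nat list set \<Rightarrow> (nat list \<Rightarrow> bool) \<Rightarrow> nat list \<Rightarrow> bool" where
  "mask K x = (\<lambda>w. w \<in> K \<and> x w)"

definition component :: "(nat list \<Rightarrow> bool) \<Rightarrow> nat list set" where
  "component x = {v. \<forall>u. prefix u v \<longrightarrow> x u}"

text \<open>The negated form makes an infinite component large for every n; \<open>card\<close>
  alone would assign it the value 0.\<close>

definition large :: "nat \<Rightarrow> (nat list \<Rightarrow> bool) \<Rightarrow> bool" where
  "large n x \<longleftrightarrow> \<not> (finite (component x) \<and> card (component x) \<le> n)"

definition prefix_closed :: "nat list set \<Rightarrow> bool" where
  "prefix_closed D \<longleftrightarrow> (\<forall>v\<in>D. \<forall>u. prefix u v \<longrightarrow> u \<in> D)"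

lemma subtree_subtree [simp]: "subtree v (subtree u x) = subtree (u @ v) x"
  by (simp add: subtree_def)

lemma subtree_Nil [simp]: "subtree [] x = x"
  by (simp add: subtree_def)

lemma prefix_closed_component: "prefix_closed (component x)"
  by (auto simp: prefix_closed_def component_def dest: prefix_order.trans)

lemma large_antimono: "large n x \<Longrightarrow> m \<le> n \<Longrightarrow> large m x"
  by (auto simp: large_def)

lemma Nil_in_prefix_closed: "prefix_closed D \<Longrightarrow> D \<noteq> {} \<Longrightarrow> [] \<in> D"
  by (auto simp: prefix_closed_def)

text \<open>Grow D one node at a time: a shortest node of P outside D has all its proper prefixes in
  D already, so adding it keeps D prefix-closed.\<close>

lemma prefix_closed_subset_of_card:
  assumes P: "prefix_closed P" and n: "\<not> (finite P \<and> card P < n)"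
  shows "\<exists>D\<subseteq>P. prefix_closed D \<and> finite D \<and> card D = n"
  using n
proof (induction n)
  case 0
  then show ?case by (intro exI[of _ "{}"]) (auto simp: prefix_closed_def)
next
  case (Suc n)
  then obtain D where D: "D \<subseteq> P" "prefix_closed D" "finite D" "card D = n"
    by (meson less_SucI)
  have "P - D \<noteq> {}"
  proof
    assume "P - D = {}"
    then have "P = D" using D by auto
    then show False using Suc.prems D by auto
  qed
  then obtain v where v: "v \<in> P - D" "\<And>w. w \<in> P - D \<Longrightarrow> length v \<le> length w"
    using arg_min_nat_lemma[of "\<lambda>v. v \<in> P - D" _ length] by blast
  have "u \<in> D" if "prefix u v" "u \<noteq> v" for u
  proof (rule ccontr)
    assume "u \<notin> D"
    moreover have "u \<in> P" using P v that by (auto simp: prefix_closed_def)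
    ultimately have "length v \<le> length u" using v by auto
    with that show False
      by (auto elim!: prefixE)
  qed
  then have "prefix_closed (insert v D)"
    using D(2) by (auto simp: prefix_closed_def)
  then show ?case
    using D v by (intro exI[of _ "insert v D"]) auto
qed

text \<open>A finite witness of exact size replaces the possibly infinite component. This form gives
  monotonicity, measurability and the link to cluster sizes.\<close>

lemma large_iff:
  "large n x \<longleftrightarrow> (\<exists>D. finite D \<and> prefix_closed D \<and> card D = Suc n \<and> (\<forall>v\<in>D. x v))"
proof
  assume "large n x"
  then have "\<not> (finite (component x) \<and> card (component x) < Suc n)"
    by (auto simp: large_def)
  from prefix_closed_subset_of_card[OF prefix_closed_component this]
  obtain D where "D \<subseteq> component x" "prefix_closed D" "finite D" "card D = Suc n"
    by blast
  then show "\<exists>D. finite D \<and> prefix_closed D \<and> card D = Suc n \<and> (\<forall>v\<in>D. x v)"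
    by (auto simp: component_def)
next
  assume "\<exists>D. finite D \<and> prefix_closed D \<and> card D = Suc n \<and> (\<forall>v\<in>D. x v)"
  then obtain D where D: "finite D" "prefix_closed D" "card D = Suc n" "\<forall>v\<in>D. x v"
    by blast
  then have "D \<subseteq> component x"
    by (auto simp: component_def prefix_closed_def)
  then have "Suc n \<le> card (component x)" if "finite (component x)"
    using card_mono[OF that, of D] D(3) by simp
  then show "large n x"
    by (auto simp: large_def)
qed

section \<open>Correspondence between clusters and prefix-closed sets\<close>

lemma tree_append [simp]: "u @ v \<in> tree r \<longleftrightarrow> u \<in> tree r \<and> v \<in> tree r"
  by (auto simp: tree_def)

lemma Nil_in_tree [simp]: "[] \<in> tree r"
  by (simp add: tree_def)

lemma tree_prefix: "v \<in> tree r \<Longrightarrow> prefix u v \<Longrightarrow> u \<in> tree r"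
  by (auto elim!: prefixE)

lemma tree_upto_eq: "tree_upto r d = {v \<in> tree r. length v \<le> d}"
  by (auto simp: tree_upto_def gen_eq_length)

text \<open>A walk inside A that starts at a topmost node v can never leave the subtree of v,
  because the only exit leads through the parent of v, which is shorter than v.\<close>

lemma cluster_between:
  assumes A: "cluster r A" and v: "v \<in> A" "\<And>w. w \<in> A \<Longrightarrow> length v \<le> length w" and w: "w \<in> A"
  shows "prefix v w \<and> (\<forall>u. prefix v u \<longrightarrow> prefix u w \<longrightarrow> u \<in> A)"
proof -
  have "(v, w) \<in> (Restr (edges r) A)\<^sup>*"
    using A v w by (auto simp: cluster_def)
  then show ?thesis
  proof (induction rule: rtrancl_induct)
    case base
    then show ?case using v prefix_order.antisym by blast
  next
    case (step w w')
    then have e: "(w, w') \<in> edges r" "w \<in> A" "w' \<in> A"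
      by auto
    then consider i where "w' = w @ [i]" | i where "w = w' @ [i]"
      by (auto simp: edges_def child_rel_def)
    then show ?case
    proof cases
      case 1
      then show ?thesis using step.IH e by (auto simp: prefix_snoc)
    next
      case 2
      \<comment> \<open>A step upwards from v itself would end in a node of A shorter than
        v.\<close>
      have "v \<noteq> w" using v(2)[OF e(3)] 2 by auto
      then have "prefix v w'" using step.IH 2 by auto
      then show ?thesis using step.IH 2 by (auto simp: prefix_snoc)
    qed
  qed
qed

lemma cluster_translate:
  assumes v: "v \<in> tree r" and D: "D \<subseteq> tree r" "prefix_closed D" "D \<noteq> {}"
  shows "cluster r ((@) v ` D)" "cluster_root r ((@) v ` D) = v"
proof -
  define A where "A = (@) v ` D"
  have vA: "v \<in> A"
    using Nil_in_prefix_closed[OF D(2,3)] by (force simp: A_def)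
  have AT: "A \<subseteq> tree r"
    using v D by (auto simp: A_def)
  have path: "(v, v @ t) \<in> (Restr (edges r) A)\<^sup>*" if "t \<in> D" for t
    using that
  proof (induction t rule: rev_induct)
    case (snoc i t)
    have "t \<in> D" using snoc.prems D(2) by (auto simp: prefix_closed_def)
    moreover have "(v @ t, v @ t @ [i]) \<in> Restr (edges r) A"
      using snoc.prems \<open>t \<in> D\<close> D(1) v
      by (auto simp: A_def edges_def child_rel_def tree_def)
    ultimately show ?case using snoc.IH by (meson rtrancl.rtrancl_into_rtrancl)
  qed simp
  have "sym (Restr (edges r) A)"
    by (auto simp: sym_def edges_def)
  then have s: "sym ((Restr (edges r) A)\<^sup>*)"
    by (rule sym_rtrancl)
  have "(a, b) \<in> (Restr (edges r) A)\<^sup>*" if "a \<in> A" "b \<in> A" for a b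
  proof -
    have "(v, a) \<in> (Restr (edges r) A)\<^sup>*" "(v, b) \<in> (Restr (edges r) A)\<^sup>*"
      using path that by (auto simp: A_def)
    then show ?thesis
      using s by (meson rtrancl_trans symD)
  qed
  then show cl: "cluster r ((@) v ` D)"
    using AT vA unfolding A_def[symmetric] cluster_def by blast
  \<comment> \<open>\<open>cluster_root\<close> is a chosen minimiser, but the choice is forced:
    every other node of A extends v and is strictly longer.\<close>
  have rt: "cluster_root r A \<in> A" "length (cluster_root r A) \<le> length v"
    using cluster_root_minimal[OF cl, folded A_def] vA AT gen_eq_length by (blast, metis subsetD)
  then show "cluster_root r ((@) v ` D) = v"
    unfolding A_def[symmetric] by (auto simp: A_def)
qed

text \<open>A cluster can be pruned to any smaller positive size without changing its root, so exact
  sizes become thresholds. Only positive sizes are described, because an infinite cluster has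
  \<open>card\<close> 0.\<close>

lemma Suc_in_cluster_sizes_iff:
  "Suc n \<in> cluster_sizes r X d \<omega>
    \<longleftrightarrow> (\<exists>v\<in>tree_upto r d. large n (subtree v (mask (tree r) (\<lambda>v. X v \<omega>))))"
proof
  assume "Suc n \<in> cluster_sizes r X d \<omega>"
  then obtain A where A: "cluster r A" "open_set X \<omega> A" "cluster_root r A \<in> tree_upto r d" "card A = Suc n"
    by (auto simp: cluster_sizes_def)
  define v where "v = cluster_root r A"
  have AT: "A \<subseteq> tree r" using A by (auto simp: cluster_def)
  have v: "v \<in> A" "\<And>w. w \<in> A \<Longrightarrow> length v \<le> length w"
  proof -
    show vA: "v \<in> A"
      using cluster_root_minimal(1)[OF A(1)] by (simp add: v_def)
    fix w assume w: "w \<in> A"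
    then have "gen r v \<le> gen r w"
      using cluster_root_minimal(2)[OF A(1)] by (simp add: v_def)
    then show "length v \<le> length w"
      using vA w AT by (metis gen_eq_length subsetD)
  qed
  note btw = cluster_between[OF A(1) v]
  define D where "D = {t. v @ t \<in> A}"
  have AD: "A = (@) v ` D"
  proof (intro set_eqI iffI)
    fix w assume w: "w \<in> A"
    then obtain t where "w = v @ t"
      using btw by (blast elim: prefixE)
    then show "w \<in> (@) v ` D"
      using w by (simp add: D_def)
  qed (auto simp: D_def)
  have inj: "inj_on ((@) v) D" by (simp add: inj_on_def)
  have "card D = Suc n"
    using A(4) unfolding AD card_image[OF inj] .
  moreover from this have "finite D"
    by (intro card_ge_0_finite) simp
  moreover have "prefix_closed D"
    unfolding prefix_closed_def D_def
  proof (intro ballI allI impI)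
    fix t u assume "t \<in> {t. v @ t \<in> A}" "prefix u t"
    then show "u \<in> {t. v @ t \<in> A}"
      using btw[of "v @ t"] by simp
  qed
  moreover have "\<forall>t\<in>D. subtree v (mask (tree r) (\<lambda>v. X v \<omega>)) t"
    using A(2) AT by (auto simp: D_def subtree_def mask_def open_set_def subset_iff)
  ultimately have "large n (subtree v (mask (tree r) (\<lambda>v. X v \<omega>)))"
    unfolding large_iff by blast
  then show "\<exists>v\<in>tree_upto r d. large n (subtree v (mask (tree r) (\<lambda>v. X v \<omega>)))"
    using A(3) v_def by blast
next
  assume "\<exists>v\<in>tree_upto r d. large n (subtree v (mask (tree r) (\<lambda>v. X v \<omega>)))"
  then obtain v D where v: "v \<in> tree_upto r d" and D: "finite D" "prefix_closed D" "card D = Suc n"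
    "\<forall>t\<in>D. subtree v (mask (tree r) (\<lambda>v. X v \<omega>)) t"
    unfolding large_iff by blast
  have vt: "v \<in> tree r" using v by (simp add: tree_upto_def)
  have Dt: "D \<subseteq> tree r" using D by (auto simp: subtree_def mask_def)
  have "D \<noteq> {}" using D by auto
  note cl = cluster_translate[OF vt Dt D(2) this]
  have "card ((@) v ` D) = Suc n"
    using D(3) by (simp add: card_image inj_on_def)
  moreover have "open_set X \<omega> ((@) v ` D)"
    using D(4) by (auto simp: open_set_def subtree_def mask_def)
  ultimately show "Suc n \<in> cluster_sizes r X d \<omega>"
    using cl v unfolding cluster_sizes_def by (intro image_eqI[of _ _ "(@) v ` D"]) auto
qed

section \<open>The largest cluster as the first threshold that fails\<close>

definition some_large :: "nat \<Rightarrow> nat \<Rightarrow> nat \<Rightarrow> (nat list \<Rightarrow> bool) \<Rightarrow> bool" where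
  "some_large r d n x \<longleftrightarrow> (\<exists>v\<in>tree_upto r d. large n (subtree v x))"

lemma some_large_antimono: "some_large r d n x \<Longrightarrow> m \<le> n \<Longrightarrow> some_large r d m x"
  unfolding some_large_def using large_antimono by blast

text \<open>The branch with \<open>the None\<close> is the value of \<open>Max\<close> on an
  infinite set. Including it describes \<open>largest_cluster\<close> at every outcome, so that it
  is measurable and not merely equal to a measurable function almost surely.\<close>

lemma largest_cluster_eq:
  fixes r d X \<omega>
  defines "x \<equiv> mask (tree r) (\<lambda>v. X v \<omega>)"
  shows "largest_cluster r X d \<omega>
    = (if \<forall>n. some_large r d n x then the None else (LEAST n. \<not> some_large r d n x))"
proof -
  let ?S = "cluster_sizes r X d \<omega>"
  have S: "Suc n \<in> ?S \<longleftrightarrow> some_large r d n x" for n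
    by (simp add: Suc_in_cluster_sizes_iff some_large_def x_def)
  show ?thesis
  proof (cases "\<forall>n. some_large r d n x")
    case True
    then have "range Suc \<subseteq> ?S" using S by auto
    then have inf: "infinite ?S"
      using range_inj_infinite[OF inj_Suc] infinite_super by blast
    then have "Max ?S = the None"
      by (rule Max.infinite)
    then show ?thesis
      using True inf by (auto simp: largest_cluster_def)
  next
    case False
    define N where "N = (LEAST n. \<not> some_large r d n x)"
    have N: "\<not> some_large r d N x"
      unfolding N_def using False by (metis LeastI)
    have below: "some_large r d n x \<longleftrightarrow> n < N" for n
      using N some_large_antimono[of r d n x N] not_less_Least[of n "\<lambda>n. \<not> some_large r d n x"]
      unfolding N_def[symmetric] by (meson not_less)
    have mem: "Suc n \<in> ?S \<longleftrightarrow> n < N" for n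
      using S below by simp
    have "?S \<subseteq> {..N}"
    proof
      fix k assume "k \<in> ?S"
      then show "k \<in> {..N}" using mem by (cases k) auto
    qed
    then have fin: "finite ?S" by (rule finite_subset) simp
    have "largest_cluster r X d \<omega> = N"
    proof (cases N)
      case 0
      \<comment> \<open>The size 0 does not have to be excluded: \<open>Max {0}\<close> and the
        convention for the empty set agree.\<close>
      then have "?S \<subseteq> {0}" using \<open>?S \<subseteq> {..N}\<close> by auto
      then show ?thesis using 0 by (auto simp: largest_cluster_def dest: subset_singletonD)
    next
      case (Suc m)
      then have "N \<in> ?S" using mem by simp
      then have "Max ?S = N"
        using fin \<open>?S \<subseteq> {..N}\<close> by (intro Max_eqI) auto
      then show ?thesis using \<open>N \<in> ?S\<close> by (auto simp: largest_cluster_def)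
    qed
    then show ?thesis unfolding if_not_P[OF False] N_def .
  qed
qed

lemma largest_cluster_le_iff:
  assumes "\<not> some_large r d k (mask (tree r) (\<lambda>v. X v \<omega>))"
  shows "largest_cluster r X d \<omega> \<le> n \<longleftrightarrow> \<not> some_large r d n (mask (tree r) (\<lambda>v. X v \<omega>))"
proof -
  let ?x = "mask (tree r) (\<lambda>v. X v \<omega>)"
  have eq: "largest_cluster r X d \<omega> = (LEAST n. \<not> some_large r d n ?x)"
    unfolding largest_cluster_eq using assms by auto
  show ?thesis
  proof
    assume "largest_cluster r X d \<omega> \<le> n"
    then show "\<not> some_large r d n ?x"
      using LeastI[of "\<lambda>n. \<not> some_large r d n ?x", OF assms] some_large_antimono
      unfolding eq by blast
  next
    assume "\<not> some_large r d n ?x"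
    then show "largest_cluster r X d \<omega> \<le> n"
      unfolding eq by (rule Least_le)
  qed
qed

section \<open>Recursive structure of the component of the root\<close>

lemma component_subset_tree: "mask (tree r) x = x \<Longrightarrow> component x \<subseteq> tree r"
  by (auto simp: component_def mask_def fun_eq_iff)

lemma component_empty_iff: "component x = {} \<longleftrightarrow> \<not> x []"
proof
  assume "component x = {}"
  then have "[] \<notin> component x" by simp
  then show "\<not> x []" by (simp add: component_def)
qed (auto simp: component_def intro!: exI[of _ "[]"])

lemma prefix_Cons_iff: "prefix u (i # v) \<longleftrightarrow> u = [] \<or> (\<exists>t. u = i # t \<and> prefix t v)"
  by (cases u) auto

lemma component_Cons_iff: "i # v \<in> component x \<longleftrightarrow> x [] \<and> v \<in> component (subtree [i] x)"
  by (auto simp: component_def prefix_Cons_iff subtree_def)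

lemma component_rec:
  assumes "mask (tree r) x = x" "x []"
  shows "component x = insert [] (\<Union>i<r. (#) i ` component (subtree [i] x))"
proof (rule set_eqI)
  fix v show "v \<in> component x \<longleftrightarrow> v \<in> insert [] (\<Union>i<r. (#) i ` component (subtree [i] x))"
  proof (cases v)
    case Nil
    then show ?thesis using assms by (simp add: component_def)
  next
    case (Cons i w)
    have "i < r" if "i # w \<in> component x"
      using that component_subset_tree[OF assms(1)] by (auto simp: tree_def)
    then show ?thesis using assms Cons by (auto simp: component_Cons_iff)
  qed
qed

definition size_eq :: "nat \<Rightarrow> (nat list \<Rightarrow> bool) \<Rightarrow> bool" where
  "size_eq n x \<longleftrightarrow> finite (component x) \<and> card (component x) = n"

lemma size_eq_0: "size_eq 0 x \<longleftrightarrow> \<not> x []"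
  by (metis card_0_eq card.empty component_empty_iff finite.emptyI size_eq_def)

text \<open>The list records the component sizes below the r children. The set
  \<open>natpermute n r\<close> is chosen because the coefficients of an r-th power of a power
  series are sums over it.\<close>

lemma size_eq_Suc_iff:
  assumes "mask (tree r) x = x"
  shows "size_eq (Suc n) x \<longleftrightarrow> x [] \<and> (\<exists>l\<in>natpermute n r. \<forall>i<r. size_eq (l ! i) (subtree [i] x))"
proof (cases "x []")
  case True
  define c where "c = (\<lambda>i. component (subtree [i] x))"
  have C: "component x = insert [] (\<Union>i<r. (#) i ` c i)"
    using component_rec[OF assms True] by (simp add: c_def)
  have fin: "finite (component x) \<longleftrightarrow> (\<forall>i<r. finite (c i))"
    unfolding C by (simp add: finite_image_iff Ball_def)
  have card: "card (component x) = Suc (\<Sum>i<r. card (c i))" if "\<forall>i<r. finite (c i)"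
  proof -
    have "card (\<Union>i<r. (#) i ` c i) = (\<Sum>i<r. card ((#) i ` c i))"
      using that by (intro card_UN_disjoint) auto
    also have "\<dots> = (\<Sum>i<r. card (c i))"
      by (intro sum.cong) (auto simp: card_image)
    finally show ?thesis
      unfolding C using that by (subst card_insert_disjoint) auto
  qed
  show ?thesis
  proof
    assume L: "size_eq (Suc n) x"
    then have f: "\<forall>i<r. finite (c i)" and "(\<Sum>i<r. card (c i)) = n"
      using fin card by (auto simp: size_eq_def)
    then have "map (\<lambda>i. card (c i)) [0..<r] \<in> natpermute n r"
      by (simp add: natpermute_def interv_sum_list_conv_sum_set_nat atLeast0LessThan)
    moreover have "\<forall>i<r. size_eq (map (\<lambda>i. card (c i)) [0..<r] ! i) (subtree [i] x)"
      using f by (simp add: size_eq_def c_def)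
    ultimately show "x [] \<and> (\<exists>l\<in>natpermute n r. \<forall>i<r. size_eq (l ! i) (subtree [i] x))"
      using True by blast
  next
    assume "x [] \<and> (\<exists>l\<in>natpermute n r. \<forall>i<r. size_eq (l ! i) (subtree [i] x))"
    then obtain l where l: "length l = r" "sum_list l = n" "\<And>i. i < r \<Longrightarrow> size_eq (l ! i) (subtree [i] x)"
      by (auto simp: natpermute_def)
    then have f: "\<forall>i<r. finite (c i)" and k: "\<And>i. i < r \<Longrightarrow> card (c i) = l ! i"
      by (auto simp: size_eq_def c_def)
    have "(\<Sum>i<r. card (c i)) = n"
      using l k by (simp add: sum_list_sum_nth atLeast0LessThan)
    then show "size_eq (Suc n) x"
      using f fin card by (simp add: size_eq_def)
  qed
next
  case False
  then have "component x = {}" by (simp add: component_empty_iff)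
  then show ?thesis using False by (simp add: size_eq_def)
qed

lemma not_large_iff: "\<not> large n x \<longleftrightarrow> (\<exists>k\<le>n. size_eq k x)"
  by (auto simp: large_def size_eq_def)

text \<open>The tree is finitely branching: a component that misses level m consists of words
  shorter than m, of which there are finitely many.\<close>

lemma infinite_component_deep:
  assumes "mask (tree r) x = x" "infinite (component x)"
  shows "\<exists>v\<in>tree r. length v = m \<and> (\<forall>u. prefix u v \<longrightarrow> x u)"
proof (rule ccontr)
  assume *: "\<not> ?thesis"
  have "component x \<subseteq> {v. set v \<subseteq> {..<r} \<and> length v \<le> m}"
  proof
    fix v assume v: "v \<in> component x"
    have "length v < m"
    proof (rule ccontr)
      assume "\<not> length v < m"
      then have tk: "take m v \<in> component x" "length (take m v) = m"
        using v prefix_closed_component[of x] take_is_prefix[of m v] by (auto simp: prefix_closed_def)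
      then have "take m v \<in> tree r"
        using component_subset_tree[OF assms(1)] by blast
      then show False
        using * tk unfolding component_def by blast
    qed
    then show "v \<in> {v. set v \<subseteq> {..<r} \<and> length v \<le> m}"
      using v component_subset_tree[OF assms(1)] by (auto simp: tree_def)
  qed
  then show False
    using assms(2) finite_lists_length_le[of "{..<r}" m] by (auto dest: finite_subset)
qed

section \<open>Tops of large clusters\<close>

lemma large_subtree_child:
  assumes "large n (subtree (u @ [i]) x)" "x u"
  shows "large n (subtree u x)"
proof -
  have "subtree [i] (subtree u x) = subtree (u @ [i]) x"
    by simp
  then have "(#) i ` component (subtree (u @ [i]) x) \<subseteq> component (subtree u x)"
    using assms(2) by (auto simp: component_Cons_iff) (simp add: subtree_def)
  moreover have "card ((#) i ` component (subtree (u @ [i]) x)) = card (component (subtree (u @ [i]) x))"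
    by (simp add: card_image)
  moreover have "finite ((#) i ` component (subtree (u @ [i]) x)) \<longleftrightarrow> finite (component (subtree (u @ [i]) x))"
    by (simp add: finite_image_iff)
  ultimately show ?thesis
    using assms(1) unfolding large_def
    by (metis card_mono finite_subset le_trans)
qed

text \<open>Nodes that are the root of a maximal large cluster, up to the boundary effect at the root of the tree.\<close>

definition top_large :: "nat \<Rightarrow> nat list \<Rightarrow> (nat list \<Rightarrow> bool) \<Rightarrow> bool" where
  "top_large n v x \<longleftrightarrow> large n (subtree v x) \<and> (v = [] \<or> \<not> x (butlast v))"

text \<open>A large node of minimal generation has a closed parent, since an open parent would be
  large as well.\<close>

lemma some_large_iff_top_large:
  "some_large r d n x \<longleftrightarrow> (\<exists>v\<in>tree_upto r d. top_large n v x)"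
proof
  assume "some_large r d n x"
  then obtain v0 where "v0 \<in> tree_upto r d \<and> large n (subtree v0 x)"
    by (auto simp: some_large_def)
  from arg_min_nat_lemma[of "\<lambda>v. v \<in> tree_upto r d \<and> large n (subtree v x)", OF this, of length]
  obtain v where v: "v \<in> tree_upto r d" "large n (subtree v x)"
    and min: "\<And>w. w \<in> tree_upto r d \<Longrightarrow> large n (subtree w x) \<Longrightarrow> length v \<le> length w"
    by auto
  have "\<not> x (butlast v)" if "v \<noteq> []"
  proof
    assume "x (butlast v)"
    moreover have "v = butlast v @ [last v]" using that by simp
    ultimately have "large n (subtree (butlast v) x)"
      using v(2) large_subtree_child by metis
    moreover have "butlast v \<in> tree_upto r d"
      using v(1) tree_prefix[OF _ prefixeq_butlast, of v r] by (auto simp: tree_upto_eq)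
    ultimately have "length v \<le> length (butlast v)"
      using min by blast
    then show False
      using that by (cases v rule: rev_cases) auto
  qed
  then show "\<exists>v\<in>tree_upto r d. top_large n v x"
    using v by (auto simp: top_large_def)
qed (auto simp: top_large_def some_large_def)

text \<open>A path that descends from outside the subtree of v into it passes through the parent of
  v, which is closed; erasing that subtree therefore changes nothing.\<close>

lemma component_mask:
  assumes "\<not> prefix v u" "\<not> x (butlast v)"
  shows "component (subtree u (mask {w. \<not> prefix v w} x)) = component (subtree u x)"
proof -
  have *: "\<not> prefix v (u @ t)" if t: "\<forall>t'. prefix t' t \<longrightarrow> x (u @ t')" for t
  proof
    assume p: "prefix v (u @ t)"
    then obtain s where s: "v = u @ s" "prefix s t"
      using assms(1) by (auto simp: prefix_append)
    then have "s \<noteq> []" using assms(1) by auto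
    then have "butlast v = u @ butlast s" using s by (simp add: butlast_append)
    moreover have "prefix (butlast s) t"
      using s(2) prefixeq_butlast prefix_order.trans by blast
    ultimately show False using t assms(2) by auto
  qed
  show ?thesis
  proof (rule set_eqI)
    fix t
    have "(\<forall>t'. prefix t' t \<longrightarrow> \<not> prefix v (u @ t') \<and> x (u @ t')) \<longleftrightarrow> (\<forall>t'. prefix t' t \<longrightarrow> x (u @ t'))"
      using * prefix_order.trans by blast
    then show "t \<in> component (subtree u (mask {w. \<not> prefix v w} x)) \<longleftrightarrow> t \<in> component (subtree u x)"
      by (simp add: component_def subtree_def mask_def)
  qed
qed

lemma large_cong: "component x = component y \<Longrightarrow> large n x = large n y"
  by (simp add: large_def)

lemma large_mono:
  assumes "large n x" "\<And>v. x v \<Longrightarrow> y v"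
  shows "large n y"
  using assms unfolding large_iff by blast

lemma some_large_blocks:
  assumes "m \<le> d"
  shows "some_large r d n x \<longleftrightarrow> (\<exists>v\<in>tree r. length v < d - m \<and> large n (subtree v x))
     \<or> (\<exists>w\<in>tree r. length w = d - m \<and> some_large r m n (subtree w x))"
proof
  assume "some_large r d n x"
  then obtain v where v: "v \<in> tree r" "length v \<le> d" "large n (subtree v x)"
    by (auto simp: some_large_def tree_upto_eq)
  show "(\<exists>v\<in>tree r. length v < d - m \<and> large n (subtree v x))
     \<or> (\<exists>w\<in>tree r. length w = d - m \<and> some_large r m n (subtree w x))"
  proof (cases "length v < d - m")
    case True
    then show ?thesis using v by blast
  next
    case False
    define w u where "w = take (d - m) v" and "u = drop (d - m) v"
    have "v = w @ u" by (simp add: w_def u_def)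
    moreover have "length w = d - m" "length u \<le> m"
      using False v(2) assms by (auto simp: w_def u_def)
    ultimately show ?thesis
      using v by (auto simp: some_large_def tree_upto_eq)
  qed
next
  assume "(\<exists>v\<in>tree r. length v < d - m \<and> large n (subtree v x))
     \<or> (\<exists>w\<in>tree r. length w = d - m \<and> some_large r m n (subtree w x))"
  then show "some_large r d n x"
  proof
    assume "\<exists>w\<in>tree r. length w = d - m \<and> some_large r m n (subtree w x)"
    then obtain w u where "w \<in> tree r" "length w = d - m" "u \<in> tree r" "length u \<le> m" "large n (subtree (w @ u) x)"
      by (auto simp: some_large_def tree_upto_eq)
    then show ?thesis
      unfolding some_large_def tree_upto_eq using assms by (intro bexI[of _ "w @ u"]) auto
  qed (auto simp: some_large_def tree_upto_eq)
qed

lemma card_tree_level: "card {v \<in> tree r. length v = m} = r ^ m"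
  using card_lists_length_eq[of "{..<r}" m] by (simp add: tree_def)

lemma finite_tree_level: "finite {v \<in> tree r. length v = m}"
  using finite_lists_length_eq[of "{..<r}" m] by (simp add: tree_def)

lemma card_tree_upto: "card (tree_upto r d) = (\<Sum>i\<le>d. r ^ i)"
  using card_lists_length_le[of "{..<r}" d] by (simp add: tree_upto_eq tree_def)

lemma finite_tree_upto: "finite (tree_upto r d)"
  using finite_lists_length_le[of "{..<r}" d] by (simp add: tree_upto_eq tree_def)

section \<open>The random configuration\<close>

abbreviation config_space :: "(nat list \<Rightarrow> bool) measure" where
  "config_space \<equiv> PiM UNIV (\<lambda>_. count_space UNIV)"

lemma measurable_coordinate [measurable]: "Measurable.pred config_space (\<lambda>x. x v)"
  by (rule measurable_component_singleton) simp

lemma measurable_large [measurable]: "Measurable.pred config_space (large n)"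
proof -
  \<comment> \<open>Encoding the witness as a list turns the quantifier into one over a countable
    type.\<close>
  have eq: "large n x \<longleftrightarrow> (\<exists>L. prefix_closed (set L) \<and> card (set L) = Suc n \<and> (\<forall>v\<in>set L. x v))" for x
    unfolding large_iff by (metis List.finite_set finite_list)
  show ?thesis
    unfolding eq[abs_def] by measurable
qed

lemma size_eq_iff_large: "size_eq n x \<longleftrightarrow> \<not> large n x \<and> (\<forall>k<n. large k x)"
  unfolding large_def size_eq_def by (auto simp: not_le not_less) (metis le_antisym not_le less_irrefl)

lemma measurable_size_eq [measurable]: "Measurable.pred config_space (size_eq n)"
  unfolding size_eq_iff_large[abs_def] by measurable

lemma measurable_subtree [measurable]: "subtree v \<in> measurable config_space config_space"
  unfolding subtree_def by (intro measurable_PiM_single') auto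

lemma measurable_mask:
  assumes "K \<subseteq> L"
  shows "mask K \<in> measurable (PiM L (\<lambda>_. count_space UNIV)) config_space"
  unfolding mask_def
proof (intro measurable_PiM_single')
  fix w :: "nat list"
  show "(\<lambda>x. w \<in> K \<and> x w) \<in> measurable (PiM L (\<lambda>_. count_space UNIV)) (count_space UNIV)"
    using assms by (cases "w \<in> K") auto
qed auto

lemma measurable_mask_config [measurable]: "mask K \<in> measurable config_space config_space"
  by (rule measurable_mask) simp

lemma measurable_some_large [measurable]: "Measurable.pred config_space (some_large r d n)"
  unfolding some_large_def[abs_def] by measurable

lemma measurable_top_large [measurable]: "Measurable.pred config_space (top_large n v)"
  unfolding top_large_def[abs_def] by measurable

locale bernoulli_tree = prob_space M for M :: "'a measure" +
  fixes r :: nat and p :: real and X :: "nat list \<Rightarrow> 'a \<Rightarrow> bool"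
  assumes r: "2 \<le> r" and p: "0 < p" "p < 1 / real r" and iid: "iid_bernoulli_tree r p M X"
begin

definition config :: "'a \<Rightarrow> nat list \<Rightarrow> bool" where
  "config \<omega> = mask (tree r) (\<lambda>v. X v \<omega>)"

lemma p_less_1: "p < 1"
proof -
  have "1 / real r \<le> 1" using r by simp
  then show ?thesis using p by linarith
qed

lemma rp_less_1: "real r * p < 1"
  using r p by (simp add: field_simps)

lemma indep: "indep_vars (\<lambda>_. count_space UNIV) X (tree r)"
  using iid by (simp add: iid_bernoulli_tree_def)

lemma random_X: "v \<in> tree r \<Longrightarrow> X v \<in> measurable M (count_space UNIV)"
  using indep by (simp add: indep_vars_def)

lemma distr_X: "v \<in> tree r \<Longrightarrow> distr M (count_space UNIV) (X v) = measure_pmf (bernoulli_pmf p)"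
  using iid by (simp add: iid_bernoulli_tree_def)

lemma law_restrict:
  "distr M (PiM (tree r) (\<lambda>_. count_space UNIV)) (\<lambda>\<omega>. \<lambda>w\<in>tree r. X w \<omega>)
    = PiM (tree r) (\<lambda>_. measure_pmf (bernoulli_pmf p))"
proof -
  have "tree r \<noteq> {}" using Nil_in_tree by blast
  then have "distr M (PiM (tree r) (\<lambda>_. count_space UNIV)) (\<lambda>\<omega>. \<lambda>w\<in>tree r. X w \<omega>)
    = PiM (tree r) (\<lambda>w. distr M (count_space UNIV) (X w))"
    using indep_vars_iff_distr_eq_PiM'[where I = "tree r" and M' = "\<lambda>_. count_space UNIV" and X = X] random_X indep by blast
  then show ?thesis
    using distr_X by (simp cong: PiM_cong)
qed

lemma measurable_config [measurable]: "config \<in> measurable M config_space"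
  unfolding config_def mask_def
proof (intro measurable_PiM_single')
  fix w :: "nat list"
  show "(\<lambda>\<omega>. w \<in> tree r \<and> X w \<omega>) \<in> measurable M (count_space UNIV)"
    using random_X by (cases "w \<in> tree r") auto
qed auto

lemma measurable_subtree_config [measurable]:
  "(\<lambda>\<omega>. subtree v (config \<omega>)) \<in> measurable M config_space"
  by (rule measurable_compose[OF measurable_config measurable_subtree])

lemma mask_config [simp]: "mask (tree r) (config \<omega>) = config \<omega>"
  by (auto simp: config_def mask_def)

text \<open>Self-similarity of the tree: prepending v reindexes an i.i.d. family injectively and so
  preserves its product law.\<close>

lemma law_subtree:
  assumes v: "v \<in> tree r"
  shows "distr M config_space (\<lambda>\<omega>. subtree v (config \<omega>)) = distr M config_space config"
proof -
  let ?N = "PiM (tree r) (\<lambda>_. count_space (UNIV :: bool set))"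
  let ?B = "PiM (tree r) (\<lambda>_. measure_pmf (bernoulli_pmf p))"
  have sets_B: "sets ?B = sets ?N"
    by (intro sets_PiM_cong) simp_all
  have meas: "(\<lambda>\<omega>. \<lambda>w\<in>tree r. X (u @ w) \<omega>) \<in> measurable M ?N" if "u \<in> tree r" for u
    using that random_X by (intro measurable_restrict) simp
  have translate: "(\<lambda>x. \<lambda>w\<in>tree r. x (v @ w)) \<in> measurable ?N ?N"
    using v by (intro measurable_restrict measurable_component_singleton) simp
  have law: "distr M ?N (\<lambda>\<omega>. \<lambda>w\<in>tree r. X (v @ w) \<omega>) = ?B"
  proof -
    have reindex: "distr ?B ?B (\<lambda>x. \<lambda>w\<in>tree r. x (v @ w)) = ?B"
      using v by (intro distr_PiM_reindex measure_pmf.prob_space_axioms) (auto simp: inj_on_def)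
    have "?B = distr ?B ?N (\<lambda>x. \<lambda>w\<in>tree r. x (v @ w))"
      using reindex distr_cong[OF refl sets_B, of ?B "\<lambda>x. \<lambda>w\<in>tree r. x (v @ w)"] by simp
    also have "\<dots> = distr (distr M ?N (\<lambda>\<omega>. \<lambda>w\<in>tree r. X w \<omega>)) ?N (\<lambda>x. \<lambda>w\<in>tree r. x (v @ w))"
      by (simp only: law_restrict)
    also have "\<dots> = distr M ?N ((\<lambda>x. \<lambda>w\<in>tree r. x (v @ w)) \<circ> (\<lambda>\<omega>. \<lambda>w\<in>tree r. X w \<omega>))"
      by (rule distr_distr[OF translate]) (use meas[of "[]"] in simp)
    also have "\<dots> = distr M ?N (\<lambda>\<omega>. \<lambda>w\<in>tree r. X (v @ w) \<omega>)"
      using v by (intro distr_cong) (auto simp: o_def fun_eq_iff)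
    finally show ?thesis by (rule sym)
  qed
  \<comment> \<open>Taken at u = v and at u = [], this exhibits both configurations as images of the
    same product law under one masking map.\<close>
  have push: "distr (distr M ?N (\<lambda>\<omega>. \<lambda>w\<in>tree r. X (u @ w) \<omega>)) config_space (mask (tree r))
      = distr M config_space (\<lambda>\<omega>. subtree u (config \<omega>))" if "u \<in> tree r" for u
  proof -
    have "mask (tree r) \<circ> (\<lambda>\<omega>. \<lambda>w\<in>tree r. X (u @ w) \<omega>) = (\<lambda>\<omega>. subtree u (config \<omega>))"
      using that by (auto simp: fun_eq_iff mask_def config_def subtree_def)
    then show ?thesis
      using distr_distr[OF measurable_mask[OF order.refl] meas[OF that]] by simp
  qed
  have law0: "distr M ?N (\<lambda>\<omega>. \<lambda>w\<in>tree r. X ([] @ w) \<omega>) = ?B"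
    using law_restrict by simp
  show ?thesis
    using push[OF v] push[of "[]"] unfolding law law0 by simp
qed

lemma prob_subtree:
  assumes "v \<in> tree r" and [measurable]: "Measurable.pred config_space Q"
  shows "prob {\<omega>\<in>space M. Q (subtree v (config \<omega>))} = prob {\<omega>\<in>space M. Q (config \<omega>)}"
proof -
  have "measure (distr M config_space (\<lambda>\<omega>. subtree v (config \<omega>))) {x\<in>space config_space. Q x}
      = measure (distr M config_space config) {x\<in>space config_space. Q x}"
    by (simp only: law_subtree[OF assms(1)])
  moreover have "(\<lambda>\<omega>. subtree v (config \<omega>)) -` {x\<in>space config_space. Q x} \<inter> space M
      = {\<omega>\<in>space M. Q (subtree v (config \<omega>))}"
    "config -` {x\<in>space config_space. Q x} \<inter> space M = {\<omega>\<in>space M. Q (config \<omega>)}"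
    by (auto simp: space_PiM)
  ultimately show ?thesis
    by (simp add: measure_distr)
qed

text \<open>Independence over disjoint sets of nodes. That the j-th event depends only on
  \<open>K j\<close> is expressed by evaluating \<open>Q j\<close> at the masked configuration, so
  no predicate on restricted functions is needed later.\<close>

lemma prob_blocks:
  assumes J: "finite J" "disjoint_family_on K J" "\<And>j. j \<in> J \<Longrightarrow> K j \<subseteq> tree r"
    and Q: "\<And>j. j \<in> J \<Longrightarrow> Measurable.pred config_space (Q j)"
  shows "prob {\<omega>\<in>space M. \<forall>j\<in>J. Q j (mask (K j) (config \<omega>))}
    = (\<Prod>j\<in>J. prob {\<omega>\<in>space M. Q j (mask (K j) (config \<omega>))})"
proof (cases "J = {}")
  case True
  then show ?thesis by (simp add: prob_space)
next
  case False
  let ?N = "\<lambda>j. PiM (K j) (\<lambda>_. count_space (UNIV :: bool set))"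
  let ?R = "\<lambda>j \<omega>. restrict (\<lambda>i. X i \<omega>) (K j)"
  define A where "A = (\<lambda>j. {x\<in>space (?N j). Q j (mask (K j) x)})"
  have ind: "indep_vars ?N ?R J"
    using indep_vars_restrict[OF indep J(3) J(2)] by simp
  have A: "A j \<in> sets (?N j)" if "j \<in> J" for j
    using measurable_compose[OF measurable_mask[OF order.refl, of "K j"] Q[OF that]]
    by (simp add: A_def pred_def)
  have eq: "?R j -` A j \<inter> space M = {\<omega>\<in>space M. Q j (mask (K j) (config \<omega>))}" if "j \<in> J" for j
  proof -
    have "mask (K j) (?R j \<omega>) = mask (K j) (config \<omega>)" for \<omega>
      using J(3)[OF that] by (auto simp: mask_def config_def fun_eq_iff)
    then show ?thesis
      by (auto simp: A_def space_PiM)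
  qed
  have "{\<omega>\<in>space M. \<forall>j\<in>J. Q j (mask (K j) (config \<omega>))} = (\<Inter>j\<in>J. ?R j -` A j \<inter> space M)"
    using False eq by auto
  also have "prob \<dots> = (\<Prod>j\<in>J. prob (?R j -` A j \<inter> space M))"
    using indep_varsD_finite[OF ind False J(1) A] by simp
  also have "\<dots> = (\<Prod>j\<in>J. prob {\<omega>\<in>space M. Q j (mask (K j) (config \<omega>))})"
    using eq by (intro prod.cong) auto
  finally show ?thesis .
qed

lemma prob_blocks2:
  assumes K: "K1 \<inter> K2 = {}" "K1 \<subseteq> tree r" "K2 \<subseteq> tree r"
    and Q: "Measurable.pred config_space Q1" "Measurable.pred config_space Q2"
  shows "prob {\<omega>\<in>space M. Q1 (mask K1 (config \<omega>)) \<and> Q2 (mask K2 (config \<omega>))}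
    = prob {\<omega>\<in>space M. Q1 (mask K1 (config \<omega>))} * prob {\<omega>\<in>space M. Q2 (mask K2 (config \<omega>))}"
proof -
  let ?K = "\<lambda>b. if b then K1 else K2" and ?Q = "\<lambda>b. if b then Q1 else Q2"
  have "disjoint_family_on ?K UNIV"
    using K by (auto simp: disjoint_family_on_def)
  from prob_blocks[OF _ this, of ?Q]
  have "prob {\<omega>\<in>space M. \<forall>b. ?Q b (mask (?K b) (config \<omega>))}
      = (\<Prod>b\<in>UNIV. prob {\<omega>\<in>space M. ?Q b (mask (?K b) (config \<omega>))})"
    using K Q by simp
  then show ?thesis
    unfolding all_bool_eq by (simp add: UNIV_bool conj_commute mult.commute)
qed

section \<open>Open paths and almost sure finiteness of clusters\<close>

lemma prob_open: "v \<in> tree r \<Longrightarrow> prob {\<omega>\<in>space M. config \<omega> v} = p"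
proof -
  assume v: "v \<in> tree r"
  have "{\<omega>\<in>space M. config \<omega> v} = X v -` {True} \<inter> space M"
    using v by (auto simp: config_def mask_def)
  then have "prob {\<omega>\<in>space M. config \<omega> v} = measure (distr M (count_space UNIV) (X v)) {True}"
    using random_X[OF v] by (simp add: measure_distr)
  then show ?thesis
    using distr_X[OF v] p p_less_1 by (simp add: measure_pmf_single)
qed

lemma prob_closed: "v \<in> tree r \<Longrightarrow> prob {\<omega>\<in>space M. \<not> config \<omega> v} = 1 - p"
proof -
  assume v: "v \<in> tree r"
  have "prob {\<omega>\<in>space M. \<not> config \<omega> v} = 1 - prob {\<omega>\<in>space M. config \<omega> v}"
    by (rule prob_neg) measurable
  then show ?thesis using prob_open[OF v] by simp
qed

lemma prob_path_open:
  assumes v: "v \<in> tree r"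
  shows "prob {\<omega>\<in>space M. \<forall>u. prefix u v \<longrightarrow> config \<omega> u} = p ^ Suc (length v)"
proof -
  let ?J = "set (prefixes v)"
  have J: "?J \<subseteq> tree r" using tree_prefix[OF v] by auto
  have "prob {\<omega>\<in>space M. \<forall>u. prefix u v \<longrightarrow> config \<omega> u}
      = prob {\<omega>\<in>space M. \<forall>u\<in>?J. (\<lambda>x. x u) (mask {u} (config \<omega>))}"
    by (simp add: mask_def Ball_def)
  also have "\<dots> = (\<Prod>u\<in>?J. prob {\<omega>\<in>space M. mask {u} (config \<omega>) u})"
    using J by (intro prob_blocks) (auto simp: disjoint_family_on_def)
  also have "\<dots> = (\<Prod>u\<in>?J. p)"
    using prob_open J by (intro prod.cong) (auto simp: mask_def)
  also have "\<dots> = p ^ Suc (length v)"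
    by (simp add: distinct_card)
  finally show ?thesis .
qed

text \<open>First moment: an infinite cluster of the root contains an open path to every level m,
  and the expected number of such paths is p(rp)^m, which tends to 0 as rp < 1.\<close>

lemma prob_always_large: "prob {\<omega>\<in>space M. \<forall>n. large n (config \<omega>)} = 0"
proof -
  have le: "prob {\<omega>\<in>space M. \<forall>n. large n (config \<omega>)} \<le> p * (real r * p) ^ m" for m
  proof -
    let ?L = "{v \<in> tree r. length v = m}"
    have "infinite (component (config \<omega>))" if "\<forall>n. large n (config \<omega>)" for \<omega>
      using that unfolding large_def by (meson order.refl)
    then have "{\<omega>\<in>space M. \<forall>n. large n (config \<omega>)}
        \<subseteq> (\<Union>v\<in>?L. {\<omega>\<in>space M. \<forall>u. prefix u v \<longrightarrow> config \<omega> u})"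
      using infinite_component_deep[OF mask_config, of _ m] by blast
    then have "prob {\<omega>\<in>space M. \<forall>n. large n (config \<omega>)}
        \<le> prob (\<Union>v\<in>?L. {\<omega>\<in>space M. \<forall>u. prefix u v \<longrightarrow> config \<omega> u})"
      by (intro finite_measure_mono) auto
    also have "\<dots> \<le> (\<Sum>v\<in>?L. prob {\<omega>\<in>space M. \<forall>u. prefix u v \<longrightarrow> config \<omega> u})"
      by (intro finite_measure_subadditive_finite finite_tree_level) auto
    also have "\<dots> = (\<Sum>v\<in>?L. p ^ Suc m)"
      by (intro sum.cong) (auto simp: prob_path_open)
    also have "\<dots> = p * (real r * p) ^ m"
      by (simp add: card_tree_level power_mult_distrib)
    finally show ?thesis .
  qed
  have "(\<lambda>m. p * (real r * p) ^ m) \<longlonglongrightarrow> p * 0"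
    using rp_less_1 p by (intro tendsto_mult tendsto_const LIMSEQ_realpow_zero) auto
  then have "prob {\<omega>\<in>space M. \<forall>n. large n (config \<omega>)} \<le> 0"
    using le by (intro LIMSEQ_le_const) auto
  then show ?thesis
    using measure_nonneg[of M "{\<omega>\<in>space M. \<forall>n. large n (config \<omega>)}"] by linarith
qed

lemma AE_not_large: "AE \<omega> in M. \<forall>v\<in>tree r. \<exists>n. \<not> large n (subtree v (config \<omega>))"
proof -
  have "AE \<omega> in M. \<exists>n. \<not> large n (subtree v (config \<omega>))" if v: "v \<in> tree r" for v
  proof -
    have "prob {\<omega>\<in>space M. \<forall>n. large n (subtree v (config \<omega>))} = 0"
      using prob_subtree[OF v, of "\<lambda>x. \<forall>n. large n x"] prob_always_large by simp
    then have "{\<omega>\<in>space M. \<forall>n. large n (subtree v (config \<omega>))} \<in> null_sets M"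
      by (intro null_setsI) (simp_all add: emeasure_eq_measure)
    from AE_not_in[OF this] AE_space show ?thesis
      by eventually_elim auto
  qed
  then show ?thesis
    by (subst AE_ball_countable) auto
qed

lemma AE_not_some_large: "AE \<omega> in M. \<forall>d. \<exists>n. \<not> some_large r d n (config \<omega>)"
  using AE_not_large
proof eventually_elim
  case (elim \<omega>)
  show ?case
  proof
    fix d
    obtain k where k: "\<And>v. v \<in> tree r \<Longrightarrow> \<not> large (k v) (subtree v (config \<omega>))"
      using elim by metis
    define n where "n = (\<Sum>v\<in>tree_upto r d. k v)"
    have "k v \<le> n" if "v \<in> tree_upto r d" for v
      unfolding n_def using finite_tree_upto that by (intro member_le_sum) auto
    then have "\<not> some_large r d n (config \<omega>)"
      unfolding some_large_def using k large_antimono by (fastforce simp: tree_upto_eq)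
    then show "\<exists>n. \<not> some_large r d n (config \<omega>)" ..
  qed
qed

end

text \<open>The tail q_n of the overview, given by the explicit size law so that it depends on r and
  p only; \<open>prob_large\<close> identifies it as a probability.\<close>

definition large_prob :: "nat \<Rightarrow> real \<Rightarrow> nat \<Rightarrow> real" where
  "large_prob r p n = 1 - (\<Sum>k\<le>n. size_prob r p k)"

text \<open>Second Bonferroni inequality with the number of pairs rounded up to the square of the
  number of events, by adding one event at a time.\<close>

lemma (in prob_space) prob_UN_ge_pairs:
  assumes "finite I" "\<And>i. i \<in> I \<Longrightarrow> A i \<in> events" "0 \<le> e"
    and "\<And>i j. i \<in> I \<Longrightarrow> j \<in> I \<Longrightarrow> i \<noteq> j \<Longrightarrow> prob (A i \<inter> A j) \<le> e"
  shows "(\<Sum>i\<in>I. prob (A i)) - real (card I) ^ 2 * e \<le> prob (\<Union>i\<in>I. A i)"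
  using assms
proof (induction I)
  case (insert a I)
  have [measurable]: "A a \<in> events" "(\<Union>i\<in>I. A i) \<in> events"
    using insert.prems insert.hyps by auto
  have "prob (A a \<inter> (\<Union>i\<in>I. A i)) = prob (\<Union>i\<in>I. A a \<inter> A i)"
    by (intro arg_cong[where f = prob]) auto
  also have "\<dots> \<le> (\<Sum>i\<in>I. prob (A a \<inter> A i))"
    using insert.prems insert.hyps by (intro finite_measure_subadditive_finite) auto
  also have "\<dots> \<le> (\<Sum>i\<in>I. e)"
    using insert.prems insert.hyps by (intro sum_mono) auto
  finally have inter: "prob (A a \<inter> (\<Union>i\<in>I. A i)) \<le> real (card I) * e"
    by simp
  have IH: "(\<Sum>i\<in>I. prob (A i)) - real (card I) ^ 2 * e \<le> prob (\<Union>i\<in>I. A i)"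
    using insert by auto
  have "real (card I) ^ 2 * e + real (card I) * e \<le> real (card (insert a I)) ^ 2 * e"
  proof -
    have "real (card I) ^ 2 + real (card I) \<le> (real (card I) + 1) ^ 2"
      by (simp add: power2_eq_square algebra_simps)
    then show ?thesis
      using insert.hyps insert.prems(2) mult_right_mono by (fastforce simp: distrib_right[symmetric] add.commute)
  qed
  moreover have "prob (A a \<union> (\<Union>i\<in>I. A i)) = prob (A a) + prob (\<Union>i\<in>I. A i) - prob (A a \<inter> (\<Union>i\<in>I. A i))"
    by (intro measure_Un3) (simp_all add: fmeasurable_eq_sets)
  ultimately show ?case
    using inter IH insert.hyps by simp
qed simp

section \<open>Law of the cluster size\<close>

context bernoulli_tree
begin

lemma size_law_Suc:
  "prob {\<omega>\<in>space M. size_eq (Suc n) (config \<omega>)}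
    = p * (\<Sum>l\<in>natpermute n r. \<Prod>i<r. prob {\<omega>\<in>space M. size_eq (l ! i) (config \<omega>)})"
proof -
  define A where "A = (\<lambda>l. {\<omega>\<in>space M. config \<omega> [] \<and> (\<forall>i<r. size_eq (l ! i) (subtree [i] (config \<omega>)))})"
  have A_meas: "A l \<in> events" for l
    unfolding A_def by measurable
  have A_prob: "prob (A l) = p * (\<Prod>i<r. prob {\<omega>\<in>space M. size_eq (l ! i) (config \<omega>)})" for l
  proof -
    \<comment> \<open>The index r, which labels no child, is used for the block consisting of the
      root alone.\<close>
    define K where "K i = (if i = r then {[]} else {w \<in> tree r. \<exists>t. w = i # t})" for i
    define Q where "Q i x \<longleftrightarrow> (if i = r then x [] else size_eq (l ! i) (subtree [i] x))" for i x
    have Q: "Q i (mask (K i) (config \<omega>)) = Q i (config \<omega>)" for i \<omega>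
    proof -
      have "subtree [i] (mask {w \<in> tree r. \<exists>t. w = i # t} (config \<omega>)) = subtree [i] (config \<omega>)"
        by (auto simp: subtree_def mask_def config_def)
      then show ?thesis by (simp add: mask_def K_def Q_def)
    qed
    have Qm: "Measurable.pred config_space (Q i)" for i
      unfolding Q_def[abs_def] by (cases "i = r") simp_all
    have disj: "disjoint_family_on K {..<Suc r}"
      unfolding disjoint_family_on_def
    proof (intro ballI impI)
      fix i j :: nat assume "i \<noteq> j"
      then show "K i \<inter> K j = {}"
        by (cases "i = r"; cases "j = r") (auto simp: K_def)
    qed
    have K: "K i \<subseteq> tree r" for i
      by (auto simp: K_def)
    have "(\<forall>i\<in>{..<Suc r}. Q i (config \<omega>)) \<longleftrightarrow> config \<omega> [] \<and> (\<forall>i<r. size_eq (l ! i) (subtree [i] (config \<omega>)))" for \<omega>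
      unfolding Q_def by (auto simp: less_Suc_eq)
    then have "A l = {\<omega>\<in>space M. \<forall>i\<in>{..<Suc r}. Q i (mask (K i) (config \<omega>))}"
      unfolding A_def Q by blast
    also have "prob \<dots> = (\<Prod>i<Suc r. prob {\<omega>\<in>space M. Q i (mask (K i) (config \<omega>))})"
      by (rule prob_blocks[OF _ disj K Qm]) simp
    also have "\<dots> = (\<Prod>i<Suc r. prob {\<omega>\<in>space M. Q i (config \<omega>)})"
      unfolding Q ..
    also have "\<dots> = (\<Prod>i<r. prob {\<omega>\<in>space M. Q i (config \<omega>)}) * prob {\<omega>\<in>space M. Q r (config \<omega>)}"
      by simp
    also have "prob {\<omega>\<in>space M. Q r (config \<omega>)} = p"
      using prob_open[of "[]"] by (simp add: Q_def)
    also have "(\<Prod>i<r. prob {\<omega>\<in>space M. Q i (config \<omega>)})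
        = (\<Prod>i<r. prob {\<omega>\<in>space M. size_eq (l ! i) (subtree [i] (config \<omega>))})"
      by (intro prod.cong refl) (simp add: Q_def)
    also have "(\<Prod>i<r. prob {\<omega>\<in>space M. size_eq (l ! i) (subtree [i] (config \<omega>))})
        = (\<Prod>i<r. prob {\<omega>\<in>space M. size_eq (l ! i) (config \<omega>)})"
      by (intro prod.cong refl prob_subtree measurable_size_eq) (simp add: tree_def)
    finally show ?thesis by simp
  qed
  have "disjoint_family_on A (natpermute n r)"
    unfolding disjoint_family_on_def
  proof (intro ballI impI)
    fix l l' assume l: "l \<in> natpermute n r" "l' \<in> natpermute n r" "l \<noteq> l'"
    then obtain i where "i < r" "l ! i \<noteq> l' ! i"
      by (auto simp: natpermute_def list_eq_iff_nth_eq)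
    then show "A l \<inter> A l' = {}"
      unfolding A_def size_eq_def by auto
  qed
  moreover have "{\<omega>\<in>space M. size_eq (Suc n) (config \<omega>)} = (\<Union>l\<in>natpermute n r. A l)"
    unfolding A_def size_eq_Suc_iff[OF mask_config] by blast
  ultimately have "prob {\<omega>\<in>space M. size_eq (Suc n) (config \<omega>)} = (\<Sum>l\<in>natpermute n r. prob (A l))"
    using finite_measure_finite_Union[of "natpermute n r" A] A_meas natpermute_finite by auto
  then show ?thesis
    by (simp add: A_prob sum_distrib_left)
qed

lemma size_law: "prob {\<omega>\<in>space M. size_eq n (config \<omega>)} = size_prob r p n"
proof -
  define s where "s = (\<lambda>n. prob {\<omega>\<in>space M. size_eq n (config \<omega>)})"
  define G where "G = Abs_fps s"
  have "G = fps_const (1 - p) + fps_const p * fps_X * G ^ r"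
  proof (rule fps_ext)
    fix n
    show "fps_nth G n = fps_nth (fps_const (1 - p) + fps_const p * fps_X * G ^ r) n"
    proof (cases n)
      case 0
      then show ?thesis using prob_closed[of "[]"] by (simp add: G_def s_def size_eq_0)
    next
      case (Suc m)
      have "{0..r - 1} = {..<r}" using r by auto
      then have "fps_nth (G ^ r) m = (\<Sum>l\<in>natpermute m r. \<Prod>i<r. s (l ! i))"
        using r by (simp add: fps_power_nth G_def)
      then show ?thesis
        using size_law_Suc[of m] Suc by (simp add: G_def s_def mult.assoc)
    qed
  qed
  \<comment> \<open>The generating function of the size law satisfies the fixed point equation, and
    the exponent 1 reads off its own coefficients.\<close>
  from fps_power_coeff_of_fixed_point[OF _ this, of 1 n]
  have "real (1 + r * n) * s n = real ((1 + r * n) choose n) * p ^ n * (1 - p) ^ (1 + (r - 1) * n)"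
    using r by (simp add: G_def)
  moreover have "real (1 + r * n) \<noteq> 0"
    by (simp only: of_nat_eq_0_iff)
  ultimately have "s n = real ((1 + r * n) choose n) * p ^ n * (1 - p) ^ (1 + (r - 1) * n) / real (1 + r * n)"
    by (metis nonzero_mult_div_cancel_left)
  then show ?thesis
    unfolding size_prob_def s_def by (simp only: times_divide_eq_left)
qed

lemma prob_large: "prob {\<omega>\<in>space M. large n (config \<omega>)} = large_prob r p n"
proof -
  have disj: "disjoint_family_on (\<lambda>k. {\<omega>\<in>space M. size_eq k (config \<omega>)}) {..n}"
    by (auto simp: disjoint_family_on_def size_eq_def)
  have "(\<lambda>k. {\<omega>\<in>space M. size_eq k (config \<omega>)}) ` {..n} \<subseteq> events"
    by (intro image_subsetI) measurable
  note finite_measure_finite_Union[OF _ this disj]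
  moreover have "{\<omega>\<in>space M. \<not> large n (config \<omega>)} = (\<Union>k\<le>n. {\<omega>\<in>space M. size_eq k (config \<omega>)})"
    unfolding not_large_iff by auto
  ultimately have "prob {\<omega>\<in>space M. \<not> large n (config \<omega>)} = (\<Sum>k\<le>n. size_prob r p k)"
    by (simp add: size_law)
  moreover have "prob {\<omega>\<in>space M. \<not> large n (config \<omega>)} = 1 - prob {\<omega>\<in>space M. large n (config \<omega>)}"
    by (rule prob_neg) measurable
  ultimately show ?thesis
    by (simp add: large_prob_def)
qed

lemma large_prob_bounds: "0 \<le> large_prob r p n" "large_prob r p n \<le> 1"
  unfolding prob_large[symmetric] by auto

lemma large_prob_tendsto_0: "large_prob r p \<longlonglongrightarrow> 0"
proof -
  have "(\<lambda>n. prob {\<omega>\<in>space M. large n (config \<omega>)}) \<longlonglongrightarrow> prob (\<Inter>n. {\<omega>\<in>space M. large n (config \<omega>)})"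
    by (rule finite_Lim_measure_decseq) (auto simp: decseq_def dest: large_antimono)
  also have "(\<Inter>n. {\<omega>\<in>space M. large n (config \<omega>)}) = {\<omega>\<in>space M. \<forall>n. large n (config \<omega>)}"
    by auto
  finally show ?thesis
    by (simp add: prob_always_large prob_large)
qed

text \<open>The total mass is 1 because clusters are almost surely finite; the sum is obtained from
  this probabilistic fact and not from the closed formula.\<close>

lemma size_prob_sums: "size_prob r p sums 1"
proof -
  have "(\<lambda>n. 1 - large_prob r p n) \<longlonglongrightarrow> 1 - 0"
    by (intro tendsto_diff tendsto_const large_prob_tendsto_0)
  then show ?thesis
    by (simp add: large_prob_def sums_def_le)
qed

section \<open>Good nodes: first and second moment bounds\<close>

lemma prob_large_subtree:
  "v \<in> tree r \<Longrightarrow> prob {\<omega>\<in>space M. large n (subtree v (config \<omega>))} = large_prob r p n"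
  using prob_subtree[of v "large n"] by (simp add: prob_large)

lemma subtree_mask_config: "subtree v (mask {w \<in> tree r. prefix v w} (config \<omega>)) = subtree v (config \<omega>)"
  by (auto simp: subtree_def mask_def config_def)

text \<open>The parent lies outside the subtree of v, hence is independent of the cluster below v.
  The root has no parent and escapes the factor 1-p.\<close>

lemma prob_top_large:
  assumes v: "v \<in> tree r"
  shows "prob {\<omega>\<in>space M. top_large n v (config \<omega>)} = (if v = [] then 1 else 1 - p) * large_prob r p n"
proof (cases "v = []")
  case True
  then show ?thesis by (simp add: top_large_def prob_large)
next
  case False
  then have "length (butlast v) < length v"
    by simp
  then have bl: "butlast v \<in> tree r" "\<not> prefix v (butlast v)"
    using tree_prefix[OF v prefixeq_butlast] prefix_length_le[of v "butlast v"] by auto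
  define K where "K = {w \<in> tree r. prefix v w}"
  have K: "{butlast v} \<inter> K = {}" "{butlast v} \<subseteq> tree r" "K \<subseteq> tree r"
    using bl by (simp_all add: K_def)
  have Q1: "Measurable.pred config_space (\<lambda>x. \<not> x (butlast v))"
    by (rule pred_intros_logic(2)[OF measurable_coordinate])
  have Q2: "Measurable.pred config_space (\<lambda>x. large n (subtree v x))"
    by (rule measurable_compose[OF measurable_subtree measurable_large])
  have [simp]: "subtree v (mask K (config \<omega>)) = subtree v (config \<omega>)"
    "mask {butlast v} (config \<omega>) (butlast v) = config \<omega> (butlast v)" for \<omega>
    unfolding K_def subtree_mask_config by (simp_all add: mask_def)
  have "{\<omega>\<in>space M. top_large n v (config \<omega>)} =
      {\<omega>\<in>space M. \<not> config \<omega> (butlast v) \<and> large n (subtree v (config \<omega>))}"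
    using False by (auto simp: top_large_def)
  then show ?thesis
    using prob_blocks2[OF K Q1 Q2] prob_closed[OF bl(1)] False v by (simp add: prob_large_subtree)
qed

text \<open>
  When the parent of v is closed, the cluster below u cannot reach v, so it is determined by the
  configuration outside the subtree of v and is independent of the cluster below v.
\<close>

lemma prob_two_top_large_aux:
  assumes uv: "u \<in> tree r" "v \<in> tree r" "\<not> prefix v u"
  shows "prob {\<omega>\<in>space M. top_large n u (config \<omega>) \<and> top_large n v (config \<omega>)} \<le> large_prob r p n ^ 2"
proof -
  let ?K1 = "{w \<in> tree r. \<not> prefix v w}" and ?K2 = "{w \<in> tree r. prefix v w}"
  have mask_K1: "mask ?K1 (config \<omega>) = mask {w. \<not> prefix v w} (config \<omega>)" for \<omega>
    by (auto simp: mask_def config_def)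
  have "prob {\<omega>\<in>space M. top_large n u (config \<omega>) \<and> top_large n v (config \<omega>)}
      \<le> prob {\<omega>\<in>space M. large n (subtree u (mask ?K1 (config \<omega>))) \<and> large n (subtree v (mask ?K2 (config \<omega>)))}"
  proof (rule finite_measure_mono)
    show "{\<omega>\<in>space M. large n (subtree u (mask ?K1 (config \<omega>))) \<and> large n (subtree v (mask ?K2 (config \<omega>)))} \<in> events"
      by measurable
    have "large n (subtree u (mask ?K1 (config \<omega>))) \<and> large n (subtree v (mask ?K2 (config \<omega>)))"
      if "top_large n u (config \<omega>)" "top_large n v (config \<omega>)" for \<omega>
    proof -
      have "v \<noteq> []" using uv(3) by auto
      then have "\<not> config \<omega> (butlast v)" using that(2) by (simp add: top_large_def)
      from component_mask[of v u "config \<omega>", OF uv(3) this]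
      have "large n (subtree u (mask {w. \<not> prefix v w} (config \<omega>))) = large n (subtree u (config \<omega>))"
        by (rule large_cong)
      then show ?thesis
        using that unfolding mask_K1 subtree_mask_config by (simp add: top_large_def)
    qed
    then show "{\<omega>\<in>space M. top_large n u (config \<omega>) \<and> top_large n v (config \<omega>)}
      \<subseteq> {\<omega>\<in>space M. large n (subtree u (mask ?K1 (config \<omega>))) \<and> large n (subtree v (mask ?K2 (config \<omega>)))}"
      by blast
  qed
  also have "\<dots> = prob {\<omega>\<in>space M. large n (subtree u (mask ?K1 (config \<omega>)))}
      * prob {\<omega>\<in>space M. large n (subtree v (mask ?K2 (config \<omega>)))}"
  proof -
    have Q: "Measurable.pred config_space (\<lambda>x. large n (subtree w x))" for w
      by (rule measurable_compose[OF measurable_subtree measurable_large])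
    have "?K1 \<inter> ?K2 = {}" "?K1 \<subseteq> tree r" "?K2 \<subseteq> tree r"
      by blast+
    from prob_blocks2[OF this Q[of u] Q[of v]] show ?thesis .
  qed
  \<comment> \<open>Masking closes nodes and can only shrink the cluster below u; below v it changes
    nothing.\<close>
  also have "\<dots> \<le> large_prob r p n * large_prob r p n"
  proof (intro mult_mono)
    have "prob {\<omega>\<in>space M. large n (subtree u (mask ?K1 (config \<omega>)))}
        \<le> prob {\<omega>\<in>space M. large n (subtree u (config \<omega>))}"
    proof (rule finite_measure_mono)
      show "{\<omega>\<in>space M. large n (subtree u (mask ?K1 (config \<omega>)))} \<subseteq> {\<omega>\<in>space M. large n (subtree u (config \<omega>))}"
        by (auto elim!: large_mono simp: subtree_def mask_def)
    qed measurable
    then show "prob {\<omega>\<in>space M. large n (subtree u (mask ?K1 (config \<omega>)))} \<le> large_prob r p n"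
      using prob_large_subtree[OF uv(1)] by simp
    show "prob {\<omega>\<in>space M. large n (subtree v (mask ?K2 (config \<omega>)))} \<le> large_prob r p n"
      using prob_large_subtree[OF uv(2)] by (simp add: subtree_mask_config)
  qed (auto simp: large_prob_bounds)
  finally show ?thesis
    by (simp add: power2_eq_square)
qed

lemma prob_two_top_large:
  assumes "u \<in> tree r" "v \<in> tree r" "u \<noteq> v"
  shows "prob {\<omega>\<in>space M. top_large n u (config \<omega>) \<and> top_large n v (config \<omega>)} \<le> large_prob r p n ^ 2"
proof (cases "prefix v u")
  case True
  then have "\<not> prefix u v" using assms(3) prefix_order.antisym by blast
  from prob_two_top_large_aux[OF assms(2,1) this] show ?thesis
    by (simp add: conj_commute)
qed (use prob_two_top_large_aux assms in blast)

text \<open>The expected number of good nodes up to generation d, divided by the tail: 1 for the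
  root and 1-p for every other node.\<close>

definition top_mean :: "nat \<Rightarrow> real" where
  "top_mean d = 1 + (1 - p) * (real (card (tree_upto r d)) - 1)"

lemma sum_prob_top_large:
  "(\<Sum>v\<in>tree_upto r d. prob {\<omega>\<in>space M. top_large n v (config \<omega>)}) = top_mean d * large_prob r p n"
proof -
  have root: "[] \<in> tree_upto r d" by (simp add: tree_upto_eq)
  have "(\<Sum>v\<in>tree_upto r d. prob {\<omega>\<in>space M. top_large n v (config \<omega>)})
      = (\<Sum>v\<in>tree_upto r d. (if v = [] then 1 else 1 - p) * large_prob r p n)"
    by (intro sum.cong prob_top_large) (auto simp: tree_upto_eq)
  also have "\<dots> = (1 + (\<Sum>v\<in>tree_upto r d - {[]}. 1 - p)) * large_prob r p n"
    unfolding sum_distrib_right[symmetric] sum.remove[OF finite_tree_upto root]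
    by (intro arg_cong2[where f = "(*)"] arg_cong2[where f = "(+)"] sum.cong) auto
  also have "(\<Sum>v\<in>tree_upto r d - {[]}. 1 - p) = (1 - p) * (real (card (tree_upto r d)) - 1)"
    using root finite_tree_upto[of r d] card_gt_0_iff[of "tree_upto r d"]
    by (auto simp: card_Diff_singleton of_nat_diff Suc_le_eq)
  finally show ?thesis
    by (simp add: top_mean_def)
qed

lemma prob_some_large_le: "prob {\<omega>\<in>space M. some_large r d n (config \<omega>)} \<le> top_mean d * large_prob r p n"
proof -
  have "{\<omega>\<in>space M. some_large r d n (config \<omega>)} = (\<Union>v\<in>tree_upto r d. {\<omega>\<in>space M. top_large n v (config \<omega>)})"
    unfolding some_large_iff_top_large by auto
  also have "prob \<dots> \<le> (\<Sum>v\<in>tree_upto r d. prob {\<omega>\<in>space M. top_large n v (config \<omega>)})"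
    by (intro finite_measure_subadditive_finite finite_tree_upto) auto
  finally show ?thesis
    by (simp only: sum_prob_top_large)
qed

lemma prob_some_large_ge:
  "top_mean d * large_prob r p n - (real (card (tree_upto r d)) * large_prob r p n) ^ 2
    \<le> prob {\<omega>\<in>space M. some_large r d n (config \<omega>)}"
proof -
  have "(\<Sum>v\<in>tree_upto r d. prob {\<omega>\<in>space M. top_large n v (config \<omega>)})
      - real (card (tree_upto r d)) ^ 2 * large_prob r p n ^ 2
    \<le> prob (\<Union>v\<in>tree_upto r d. {\<omega>\<in>space M. top_large n v (config \<omega>)})"
  proof (intro prob_UN_ge_pairs finite_tree_upto)
    fix u v assume uv: "u \<in> tree_upto r d" "v \<in> tree_upto r d" "u \<noteq> v"
    have "{\<omega>\<in>space M. top_large n u (config \<omega>)} \<inter> {\<omega>\<in>space M. top_large n v (config \<omega>)}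
        = {\<omega>\<in>space M. top_large n u (config \<omega>) \<and> top_large n v (config \<omega>)}"
      by auto
    then show "prob ({\<omega>\<in>space M. top_large n u (config \<omega>)} \<inter> {\<omega>\<in>space M. top_large n v (config \<omega>)})
        \<le> large_prob r p n ^ 2"
      using prob_two_top_large[of u v n] uv by (simp add: tree_upto_eq)
  qed auto
  also have "(\<Union>v\<in>tree_upto r d. {\<omega>\<in>space M. top_large n v (config \<omega>)}) = {\<omega>\<in>space M. some_large r d n (config \<omega>)}"
    unfolding some_large_iff_top_large by auto
  finally show ?thesis
    by (simp only: sum_prob_top_large power_mult_distrib)
qed

section \<open>Independent blocks below the cut\<close>

lemma prob_no_large_block:
  "prob {\<omega>\<in>space M. \<forall>w\<in>{w \<in> tree r. length w = k}. \<not> some_large r m n (subtree w (config \<omega>))}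
    = (1 - prob {\<omega>\<in>space M. some_large r m n (config \<omega>)}) ^ (r ^ k)"
proof -
  let ?J = "{w \<in> tree r. length w = k}" and ?K = "\<lambda>w. {u \<in> tree r. prefix w u}"
  have disj: "disjoint_family_on ?K ?J"
    unfolding disjoint_family_on_def
  proof (intro ballI impI)
    fix w w' assume w: "w \<in> ?J" "w' \<in> ?J" "w \<noteq> w'"
    have "w = take k u" if "prefix w u" for u
      using that w(1) by (auto elim!: prefixE)
    moreover have "w' = take k u" if "prefix w' u" for u
      using that w(2) by (auto elim!: prefixE)
    ultimately show "?K w \<inter> ?K w' = {}"
      using w(3) by auto
  qed
  have "prob {\<omega>\<in>space M. \<forall>w\<in>?J. \<not> some_large r m n (subtree w (config \<omega>))}
      = prob {\<omega>\<in>space M. \<forall>w\<in>?J. \<not> some_large r m n (subtree w (mask (?K w) (config \<omega>)))}"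
    unfolding subtree_mask_config ..
  also have "\<dots> = (\<Prod>w\<in>?J. prob {\<omega>\<in>space M. \<not> some_large r m n (subtree w (mask (?K w) (config \<omega>)))})"
  proof (rule prob_blocks[where Q = "\<lambda>w x. \<not> some_large r m n (subtree w x)", OF finite_tree_level disj])
    show "Measurable.pred config_space (\<lambda>x. \<not> some_large r m n (subtree w x))" for w
      by (intro pred_intros_logic measurable_compose[OF measurable_subtree measurable_some_large])
  qed blast
  also have "\<dots> = (\<Prod>w\<in>?J. 1 - prob {\<omega>\<in>space M. some_large r m n (config \<omega>)})"
  proof (intro prod.cong refl)
    fix w assume "w \<in> ?J"
    then have "prob {\<omega>\<in>space M. \<not> some_large r m n (subtree w (mask (?K w) (config \<omega>)))}
        = prob {\<omega>\<in>space M. \<not> some_large r m n (config \<omega>)}"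
      unfolding subtree_mask_config using prob_subtree[of w "\<lambda>x. \<not> some_large r m n x"] by simp
    also have "\<dots> = 1 - prob {\<omega>\<in>space M. some_large r m n (config \<omega>)}"
      by (rule prob_neg) measurable
    finally show "prob {\<omega>\<in>space M. \<not> some_large r m n (subtree w (mask (?K w) (config \<omega>)))}
        = 1 - prob {\<omega>\<in>space M. some_large r m n (config \<omega>)}" .
  qed
  finally show ?thesis
    by (simp add: card_tree_level)
qed

lemma prob_no_large_le:
  assumes "m \<le> d"
  shows "prob {\<omega>\<in>space M. \<not> some_large r d n (config \<omega>)}
    \<le> (1 - prob {\<omega>\<in>space M. some_large r m n (config \<omega>)}) ^ (r ^ (d - m))"
  unfolding prob_no_large_block[symmetric] some_large_blocks[OF assms]
  by (intro finite_measure_mono) (auto intro!: sets.sets_Collect_finite_All finite_tree_level)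

lemma prob_no_large_ge:
  assumes "m \<le> d"
  shows "(1 - prob {\<omega>\<in>space M. some_large r m n (config \<omega>)}) ^ (r ^ (d - m))
      - real (card (tree_upto r (d - m))) * large_prob r p n
    \<le> prob {\<omega>\<in>space M. \<not> some_large r d n (config \<omega>)}"
proof -
  let ?A = "{\<omega>\<in>space M. \<forall>w\<in>{w \<in> tree r. length w = d - m}. \<not> some_large r m n (subtree w (config \<omega>))}"
  let ?B = "{\<omega>\<in>space M. some_large r (d - m) n (config \<omega>)}"
  \<comment> \<open>The nodes strictly above the cut are covered by all nodes up to generation d -
    m. The extra level changes the union bound only by a constant factor.\<close>
  have "?A \<subseteq> {\<omega>\<in>space M. \<not> some_large r d n (config \<omega>)} \<union> ?B"
    unfolding some_large_blocks[OF assms] by (auto simp: some_large_def tree_upto_eq)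
  then have "prob ?A \<le> prob ({\<omega>\<in>space M. \<not> some_large r d n (config \<omega>)} \<union> ?B)"
    by (intro finite_measure_mono) auto
  also have "\<dots> \<le> prob {\<omega>\<in>space M. \<not> some_large r d n (config \<omega>)} + prob ?B"
    by (intro measure_Un_le) auto
  also have "prob ?B \<le> (\<Sum>v\<in>tree_upto r (d - m). prob {\<omega>\<in>space M. large n (subtree v (config \<omega>))})"
  proof -
    have "?B = (\<Union>v\<in>tree_upto r (d - m). {\<omega>\<in>space M. large n (subtree v (config \<omega>))})"
      by (auto simp: some_large_def)
    then show ?thesis
      by (auto intro!: finite_measure_subadditive_finite finite_tree_upto)
  qed
  also have "\<dots> = real (card (tree_upto r (d - m))) * large_prob r p n"
    by (simp add: prob_large_subtree tree_upto_eq)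
  finally show ?thesis
    unfolding prob_no_large_block by simp
qed

lemma measurable_largest_cluster [measurable]:
  "largest_cluster r X d \<in> measurable M (count_space UNIV)"
  unfolding largest_cluster_eq[abs_def] config_def[symmetric] by measurable

lemma prob_largest_cluster_le:
  "prob {\<omega>\<in>space M. largest_cluster r X d \<omega> \<le> n} = prob {\<omega>\<in>space M. \<not> some_large r d n (config \<omega>)}"
proof (rule finite_measure_eq_AE)
  show "AE \<omega> in M. \<omega> \<in> {\<omega>\<in>space M. largest_cluster r X d \<omega> \<le> n}
      \<longleftrightarrow> \<omega> \<in> {\<omega>\<in>space M. \<not> some_large r d n (config \<omega>)}"
    using AE_not_some_large
    by eventually_elim (use largest_cluster_le_iff[of r d _ X] in \<open>auto simp: config_def\<close>)
qed measurable

end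

section \<open>Poisson approximation\<close>

text \<open>The limit of q_n / (n^(-3/2) kappa^n): the constant of the size law times the geometric
  factor from summing the tail.\<close>

definition tail_const :: "nat \<Rightarrow> real \<Rightarrow> real" where
  "tail_const r p = lim (\<lambda>n. size_prob r p n / (real n powr (- 3 / 2) * kappa r p ^ n))
     * kappa r p / (1 - kappa r p)"

text \<open>The constant C_0 of the overview. Its factors come from the closed parent, from the
  number of nodes up to generation d relative to r^d, from the tail, and from replacing n^(-3/2) by
  d^(-3/2) when n is asymptotic to d / log_r(1/kappa).\<close>

definition mean_const :: "nat \<Rightarrow> real \<Rightarrow> real" where
  "mean_const r p = (1 - p) * (real r / (real r - 1)) *
     (tail_const r p * (1 / log (real r) (1 / kappa r p)) powr (- 3 / 2))"

lemma less_inverse_of_nat_imp_less_1: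
  fixes p :: real
  assumes "2 \<le> r" "p < 1 / real r"
  shows "p < 1"
proof -
  have "1 / real r \<le> 1" using assms by simp
  then show ?thesis using assms by linarith
qed

lemma log_inverse_kappa_pos:
  assumes "2 \<le> r" "0 < p" "p < 1 / real r"
  shows "0 < log (real r) (1 / kappa r p)"
proof -
  have "p < 1" using less_inverse_of_nat_imp_less_1 assms by blast
  then have "0 < kappa r p" "kappa r p < 1"
    using kappa_pos[of r p] kappa_less_1[of r p] assms by auto
  then show ?thesis
    using assms by simp
qed

lemma size_prob_lim:
  assumes "2 \<le> r" "0 < p" "p < 1"
  shows "(\<lambda>n. size_prob r p n / (real n powr (- 3 / 2) * kappa r p ^ n))
      \<longlonglongrightarrow> lim (\<lambda>n. size_prob r p n / (real n powr (- 3 / 2) * kappa r p ^ n))"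
    and "0 < lim (\<lambda>n. size_prob r p n / (real n powr (- 3 / 2) * kappa r p ^ n))"
proof -
  obtain c where c: "0 < c" "(\<lambda>n. size_prob r p n / (real n powr (- 3 / 2) * kappa r p ^ n)) \<longlonglongrightarrow> c"
    using size_prob_asymp[OF assms] .
  show "(\<lambda>n. size_prob r p n / (real n powr (- 3 / 2) * kappa r p ^ n))
      \<longlonglongrightarrow> lim (\<lambda>n. size_prob r p n / (real n powr (- 3 / 2) * kappa r p ^ n))"
    and "0 < lim (\<lambda>n. size_prob r p n / (real n powr (- 3 / 2) * kappa r p ^ n))"
    unfolding limI[OF c(2)] by (rule c)+
qed

lemma mean_const_pos:
  assumes "2 \<le> r" "0 < p" "p < 1 / real r"
  shows "0 < tail_const r p" "0 < mean_const r p"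
proof -
  have p1: "p < 1" using less_inverse_of_nat_imp_less_1 assms by blast
  then show t: "0 < tail_const r p"
    using assms kappa_pos[of r p] kappa_less_1[of r p] size_prob_lim(2)[of r p]
    by (auto simp: tail_const_def)
  show "0 < mean_const r p"
    using t log_inverse_kappa_pos[OF assms] assms p1 by (auto simp: mean_const_def)
qed

text \<open>The defining property of the centering: at n = mu_d the number r^d of nodes balances
  d^(-3/2) kappa^n exactly.\<close>

lemma kappa_powr_mu:
  assumes r: "2 \<le> r" and p: "0 < p" "p < 1 / real r" and d: "1 \<le> d"
  shows "kappa r p powr (mu r p d) = real d powr (3 / 2) / real r ^ d"
proof -
  have "p < 1" using less_inverse_of_nat_imp_less_1 r p by blast
  then have k: "0 < kappa r p"
    using kappa_pos[of r p] r p by auto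
  have lr: "0 < ln (real r)" using r by simp
  have L: "log (real r) (1 / kappa r p) = - ln (kappa r p) / ln (real r)"
    using k by (simp add: log_def ln_div)
  have lk: "ln (kappa r p) \<noteq> 0"
    using log_inverse_kappa_pos[OF r p] unfolding L by auto
  have "mu r p d * ln (kappa r p) = 3 / 2 * ln (real d) - real d * ln (real r)"
    using lr lk unfolding mu_def L by (simp add: log_def field_simps)
  then have "kappa r p powr (mu r p d) = exp (3 / 2 * ln (real d) - real d * ln (real r))"
    using k by (simp add: powr_def)
  also have "\<dots> = real d powr (3 / 2) / real r ^ d"
    using d r by (simp add: exp_diff powr_def exp_of_nat_mult)
  finally show ?thesis .
qed

lemma mu_over_d_tendsto:
  assumes "2 \<le> r" "0 < p" "p < 1 / real r"
  shows "(\<lambda>d. mu r p d / real d) \<longlonglongrightarrow> 1 / log (real r) (1 / kappa r p)"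
proof -
  have "(\<lambda>d. (1 - 3 / 2 / ln (real r) * (ln (real d) / real d)) / log (real r) (1 / kappa r p))
      \<longlonglongrightarrow> (1 - 3 / 2 / ln (real r) * 0) / log (real r) (1 / kappa r p)"
  proof (intro tendsto_divide tendsto_diff tendsto_mult tendsto_const)
    show "(\<lambda>d. ln (real d) / real d) \<longlonglongrightarrow> 0" by real_asymp
  qed (use log_inverse_kappa_pos[OF assms] assms in auto)
  then have "(\<lambda>d. (1 - 3 / 2 / ln (real r) * (ln (real d) / real d)) / log (real r) (1 / kappa r p))
      \<longlonglongrightarrow> 1 / log (real r) (1 / kappa r p)"
    by simp
  then show ?thesis
  proof (rule Lim_transform_eventually)
    show "\<forall>\<^sub>F d in sequentially. (1 - 3 / 2 / ln (real r) * (ln (real d) / real d)) / log (real r) (1 / kappa r p)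
        = mu r p d / real d"
      using eventually_gt_at_top[of 0]
      by eventually_elim (simp add: mu_def log_def field_simps)
  qed
qed

section \<open>Elementary exponential inequalities\<close>

lemma exp_minus_bounds:
  fixes y :: real
  assumes "0 \<le> y"
  shows "\<bar>(1 - y) - exp (- y)\<bar> \<le> y ^ 2"
proof -
  have "1 - y \<le> exp (- y)"
    using exp_ge_add_one_self[of "- y"] by simp
  moreover have "exp (- y) \<le> 1 - y + y ^ 2"
  proof -
    have "exp (- y) \<le> 1 / (1 + y)"
      using exp_ge_add_one_self[of y] assms by (simp add: exp_minus inverse_eq_divide frac_le)
    also have "\<dots> \<le> 1 - y + y ^ 2"
    proof -
      have "(1 - y + y ^ 2) * (1 + y) = 1 + y ^ 3"
        by (simp add: power2_eq_square power3_eq_cube algebra_simps)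
      then show ?thesis
        using assms by (simp add: pos_divide_le_eq)
    qed
    finally show ?thesis .
  qed
  ultimately show ?thesis by simp
qed

text \<open>Binomial versus Poisson: n-th powers of two numbers in [0,1] differ by at most n times
  their difference, and 1-y differs from exp(-y) by at most y^2.\<close>

lemma power_one_minus_exp:
  fixes y :: real
  assumes "0 \<le> y" "y \<le> 1"
  shows "\<bar>(1 - y) ^ n - exp (- (real n * y))\<bar> \<le> real n * y ^ 2"
proof -
  have "exp (- (real n * y)) = exp (- y) ^ n"
    by (simp add: exp_of_nat_mult[symmetric])
  then have "\<bar>(1 - y) ^ n - exp (- (real n * y))\<bar> \<le> real n * \<bar>(1 - y) - exp (- y)\<bar>"
    using norm_power_diff[of "1 - y" "exp (- y)" n] assms by simp
  also have "\<dots> \<le> real n * y ^ 2"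
    using exp_minus_bounds[OF assms(1)] by (intro mult_left_mono) auto
  finally show ?thesis .
qed

lemma abs_exp_minus_diff_le:
  fixes a b :: real
  assumes "0 \<le> a" "0 \<le> b"
  shows "\<bar>exp (- a) - exp (- b)\<bar> \<le> \<bar>a - b\<bar>"
proof -
  have *: "\<bar>exp (- a) - exp (- b)\<bar> \<le> \<bar>a - b\<bar>" if "0 \<le> a" "a \<le> b" for a b :: real
  proof -
    have "exp (- a) - exp (- b) = exp (- a) * (1 - exp (- (b - a)))"
      by (simp add: exp_minus exp_diff field_simps)
    also have "\<dots> \<le> 1 * (b - a)"
    proof (intro mult_mono)
      show "1 - exp (- (b - a)) \<le> b - a"
        using exp_ge_add_one_self[of "- (b - a)"] by linarith
    qed (use that in auto)
    finally show ?thesis using that by simp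
  qed
  show ?thesis
    using *[of a b] *[of b a] assms by (cases "a \<le> b") (auto simp: abs_minus_commute)
qed

section \<open>Asymptotics of the probability that no large cluster exists\<close>

context bernoulli_tree
begin

lemma kappa_bounds: "0 < kappa r p" "kappa r p < 1"
  using kappa_pos kappa_less_1 r p p_less_1 by auto

lemma large_prob_asymp:
  "(\<lambda>n. large_prob r p n / (real n powr (- 3 / 2) * kappa r p ^ n)) \<longlonglongrightarrow> tail_const r p"
  unfolding large_prob_def tail_const_def
  by (rule tail_asymp[OF kappa_bounds size_prob_lim(1) size_prob_sums]) (use r p p_less_1 in auto)

lemma card_tree_upto_real: "real (card (tree_upto r m)) = (real r ^ Suc m - 1) / (real r - 1)"
proof -
  have "real (card (tree_upto r m)) = (\<Sum>i<Suc m. real r ^ i)"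
    by (simp only: card_tree_upto lessThan_Suc_atMost of_nat_sum of_nat_power)
  also have "\<dots> = (real r ^ Suc m - 1) / (real r - 1)"
    using r by (intro geometric_sum) simp
  finally show ?thesis .
qed

lemma card_tree_upto_ratio:
  "(\<lambda>m. real (card (tree_upto r m)) / real r ^ m) \<longlonglongrightarrow> real r / (real r - 1)"
proof -
  have "(\<lambda>m. (real r - (1 / real r) ^ m) / (real r - 1)) \<longlonglongrightarrow> (real r - 0) / (real r - 1)"
    using r by (intro tendsto_divide tendsto_diff tendsto_const LIMSEQ_realpow_zero) auto
  moreover have "(real r - (1 / real r) ^ m) / (real r - 1) = real (card (tree_upto r m)) / real r ^ m" for m
    using r by (simp add: card_tree_upto_real field_simps)
  ultimately show ?thesis by simp
qed

lemma top_mean_ratio: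
  "(\<lambda>m. top_mean m / real r ^ m) \<longlonglongrightarrow> (1 - p) * (real r / (real r - 1))"
proof -
  have "(\<lambda>m. p * (1 / real r) ^ m + (1 - p) * (real (card (tree_upto r m)) / real r ^ m))
      \<longlonglongrightarrow> p * 0 + (1 - p) * (real r / (real r - 1))"
    using r by (intro tendsto_add tendsto_mult tendsto_const card_tree_upto_ratio LIMSEQ_realpow_zero) auto
  moreover have "p * (1 / real r) ^ m + (1 - p) * (real (card (tree_upto r m)) / real r ^ m)
      = top_mean m / real r ^ m" for m
    using r by (simp add: top_mean_def field_simps)
  ultimately show ?thesis by simp
qed

text \<open>Bounded distance from mu_d fixes the limit of N_d/d, which converts N_d^(-3/2) into a
  constant times d^(-3/2); together with r^d this factor is absorbed by kappa^(-mu_d).\<close>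

lemma large_prob_scaled:
  fixes N :: "nat \<Rightarrow> nat"
  assumes B: "\<forall>\<^sub>F d in sequentially. \<bar>real (N d) - mu r p d\<bar> \<le> B"
  shows "(\<lambda>d. real r ^ d * large_prob r p (N d) / kappa r p powr (real (N d) - mu r p d))
    \<longlonglongrightarrow> tail_const r p * (1 / log (real r) (1 / kappa r p)) powr (- 3 / 2)"
proof -
  let ?k = "kappa r p" and ?L = "log (real r) (1 / kappa r p)"
  have L: "0 < ?L" using log_inverse_kappa_pos[OF r p] .
  have "(\<lambda>d. (real (N d) - mu r p d) / real d) \<longlonglongrightarrow> 0"
  proof (rule Lim_null_comparison)
    show "\<forall>\<^sub>F d in sequentially. norm ((real (N d) - mu r p d) / real d) \<le> B / real d"
      using B by eventually_elim (simp add: divide_right_mono)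
    show "(\<lambda>d. B / real d) \<longlonglongrightarrow> 0" by real_asymp
  qed
  from tendsto_add[OF this mu_over_d_tendsto[OF r p]]
  have ratio: "(\<lambda>d. real (N d) / real d) \<longlonglongrightarrow> 1 / ?L"
    by (simp add: diff_divide_distrib)
  have N_top: "filterlim N at_top sequentially"
  proof -
    have "filterlim (\<lambda>d. real (N d) / real d * real d) at_top sequentially"
      by (rule filterlim_tendsto_pos_mult_at_top[OF ratio _ filterlim_real_sequentially]) (use L in simp)
    moreover have "\<forall>\<^sub>F d in sequentially. real (N d) / real d * real d = real (N d)"
      using eventually_gt_at_top[of 0] by eventually_elim simp
    ultimately have "filterlim (\<lambda>d. real (N d)) at_top sequentially"
      by (rule filterlim_cong[OF refl refl, THEN iffD1, rotated])
    then show ?thesis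
      by (simp add: filterlim_sequentially_iff_filterlim_real)
  qed
  have "(\<lambda>d. large_prob r p (N d) / (real (N d) powr (- 3 / 2) * ?k ^ N d) * (real (N d) / real d) powr (- 3 / 2))
      \<longlonglongrightarrow> tail_const r p * (1 / ?L) powr (- 3 / 2)"
    using L by (intro tendsto_mult filterlim_compose[OF large_prob_asymp N_top] tendsto_powr ratio tendsto_const) auto
  then show ?thesis
  proof (rule Lim_transform_eventually)
    show "\<forall>\<^sub>F d in sequentially.
      large_prob r p (N d) / (real (N d) powr (- 3 / 2) * ?k ^ N d) * (real (N d) / real d) powr (- 3 / 2)
      = real r ^ d * large_prob r p (N d) / ?k powr (real (N d) - mu r p d)"
      using eventually_ge_at_top[of 1] filterlim_at_top[THEN iffD1, rule_format, OF N_top, of 1]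
    proof eventually_elim
      case (elim d)
      have k: "?k powr (real (N d) - mu r p d) = ?k ^ N d * real r ^ d / real d powr (3 / 2)"
        using kappa_powr_mu[OF r p elim(1)] kappa_bounds r by (simp add: powr_diff powr_realpow)
      have "(real (N d) / real d) powr (- 3 / 2) = real (N d) powr (- 3 / 2) * real d powr (3 / 2)"
        using elim by (simp add: powr_divide powr_minus_divide)
      moreover have "0 < real (N d) powr (- 3 / 2)" "0 < real d powr (3 / 2)" "0 < real r ^ d"
        using elim r by auto
      ultimately show ?case
        unfolding k using kappa_bounds by (simp add: field_simps)
    qed
  qed
qed

text \<open>Stated as a vanishing difference, since the exponential term oscillates with the
  fractional part of mu_d and has no limit to refer to.\<close>

lemma no_large_asymp:
  fixes N :: "nat \<Rightarrow> nat"
  assumes B: "\<forall>\<^sub>F d in sequentially. \<bar>real (N d) - mu r p d\<bar> \<le> B"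
  shows "(\<lambda>d. prob {\<omega>\<in>space M. \<not> some_large r d (N d) (config \<omega>)}
      - exp (- mean_const r p * kappa r p powr (real (N d) - mu r p d))) \<longlonglongrightarrow> 0"
proof -
  define R where "R = real r"
  define e where "e d = kappa r p powr (real (N d) - mu r p d)" for d
  \<comment> \<open>An eventual upper bound of e, used in all error estimates: kappa < 1 and the
    exponent is at least -B.\<close>
  define E where "E = kappa r p powr (- B)"
  define q where "q d = large_prob r p (N d)" for d
  define a where "a d = R ^ d * q d / e d" for d
  define m where "m d = d div 2" for d :: nat
  define c where "c k = real (card (tree_upto r k)) / R ^ k" for k
  define t where "t d = top_mean (m d) / R ^ m d * a d" for d
  define y where "y d = prob {\<omega>\<in>space M. some_large r (m d) (N d) (config \<omega>)}" for d
  define P where "P d = prob {\<omega>\<in>space M. \<not> some_large r d (N d) (config \<omega>)}" for d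
  define C0 where "C0 = mean_const r p"
  have R: "2 \<le> R" using r by (simp add: R_def)
  have C0: "0 \<le> C0" using mean_const_pos(2)[OF r p] by (simp add: C0_def)
  have e0: "0 < e d" for d using kappa_bounds by (simp add: e_def)
  have E0: "0 < E" using kappa_bounds by (simp add: E_def)
  have eE: "\<forall>\<^sub>F d in sequentially. e d \<le> E"
    using B unfolding e_def E_def
    by eventually_elim (use kappa_bounds in \<open>auto intro!: powr_mono'\<close>)
  have m_le: "m d \<le> d" for d by (simp add: m_def)
  have Rd: "R ^ d = R ^ m d * R ^ (d - m d)" for d
    using m_le by (simp flip: power_add)
  have m_top: "filterlim m at_top sequentially" "filterlim (\<lambda>d. d - m d) at_top sequentially"
  proof -
    have "\<forall>\<^sub>F d in sequentially. Z \<le> m d" "\<forall>\<^sub>F d in sequentially. Z \<le> d - m d" for Z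
      using eventually_ge_at_top[of "2 * Z"] by (eventually_elim, simp add: m_def)+
    then show "filterlim m at_top sequentially" "filterlim (\<lambda>d. d - m d) at_top sequentially"
      by (simp_all add: filterlim_at_top)
  qed
  have a: "a \<longlonglongrightarrow> tail_const r p * (1 / log (real r) (1 / kappa r p)) powr (- 3 / 2)"
    using large_prob_scaled[OF B] unfolding a_def q_def e_def R_def .
  have c: "c \<longlonglongrightarrow> R / (R - 1)"
    using card_tree_upto_ratio unfolding c_def R_def .
  note cm = filterlim_compose[OF c m_top(1)] filterlim_compose[OF c m_top(2)]
  have t: "t \<longlonglongrightarrow> C0"
    unfolding t_def C0_def mean_const_def R_def
    by (intro tendsto_mult[OF filterlim_compose[OF top_mean_ratio m_top(1)]] a)
  have inv: "(\<lambda>k. (1 / R) ^ k) \<longlonglongrightarrow> 0"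
    using R by (intro LIMSEQ_realpow_zero) auto
  note invm = filterlim_compose[OF inv m_top(1)] filterlim_compose[OF inv m_top(2)]
  \<comment> \<open>The tail has order R^(-d) and is split along the cut: R^(-m) is spent on the
    nodes of one block, R^(-(d-m)) on the number of blocks.\<close>
  have q_eq: "q d = a d * e d * (1 / R) ^ m d * (1 / R) ^ (d - m d)" for d
    using R e0[of d] Rd[of d] by (simp add: a_def field_simps)
  have a0: "0 \<le> a d" for d
    using e0[of d] large_prob_bounds(1) R by (simp add: a_def q_def)
  have q0: "0 \<le> q d" for d using large_prob_bounds(1) by (simp add: q_def)
  have y01: "0 \<le> y d" "y d \<le> 1" for d by (auto simp: y_def)
  have c0: "0 \<le> c k" for k using R by (simp add: c_def)
  have Ry_le: "R ^ (d - m d) * y d \<le> t d * e d" for d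
  proof -
    have "R ^ (d - m d) * y d \<le> R ^ (d - m d) * (top_mean (m d) * q d)"
      unfolding y_def q_def using R by (intro mult_left_mono prob_some_large_le) auto
    also have "\<dots> = t d * e d"
      unfolding q_eq t_def using R by (simp add: power_divide)
    finally show ?thesis .
  qed
  have Ry_ge: "t d * e d - (c (m d) * a d * e d) ^ 2 * (1 / R) ^ (d - m d) \<le> R ^ (d - m d) * y d" for d
  proof -
    have "t d * e d - (c (m d) * a d * e d) ^ 2 * (1 / R) ^ (d - m d)
        = R ^ (d - m d) * (top_mean (m d) * q d - (real (card (tree_upto r (m d))) * q d) ^ 2)"
      unfolding q_eq t_def c_def using R by (simp add: power_divide power2_eq_square right_diff_distrib)
    also have "\<dots> \<le> R ^ (d - m d) * y d"
      unfolding y_def q_def using R by (intro mult_left_mono prob_some_large_ge) auto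
    finally show ?thesis .
  qed
  \<comment> \<open>The expected number of blocks with a good node approaches C0 e; the Bonferroni
    correction carries the spare factor R^(-(d-m)).\<close>
  have d1: "(\<lambda>d. R ^ (d - m d) * y d - C0 * e d) \<longlonglongrightarrow> 0"
  proof (rule Lim_null_comparison)
    show "\<forall>\<^sub>F d in sequentially. norm (R ^ (d - m d) * y d - C0 * e d)
        \<le> \<bar>t d - C0\<bar> * E + (c (m d) * a d * E) ^ 2 * (1 / R) ^ (d - m d)"
      using eE
    proof eventually_elim
      case (elim d)
      have "\<bar>t d - C0\<bar> * e d \<le> \<bar>t d - C0\<bar> * E"
        using elim by (intro mult_left_mono) auto
      moreover have "\<bar>t d * e d - C0 * e d\<bar> = \<bar>t d - C0\<bar> * e d"
        using e0[of d] by (simp add: abs_mult flip: left_diff_distrib)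
      moreover have "(c (m d) * a d * e d) ^ 2 * (1 / R) ^ (d - m d) \<le> (c (m d) * a d * E) ^ 2 * (1 / R) ^ (d - m d)"
        using elim e0[of d] a0[of d] c0 R by (intro mult_right_mono power_mono mult_left_mono) auto
      ultimately show ?case
        using Ry_le[of d] Ry_ge[of d] unfolding real_norm_def by linarith
    qed
    have "(\<lambda>d. \<bar>t d - C0\<bar> * E + (c (m d) * a d * E) ^ 2 * (1 / R) ^ (d - m d))
        \<longlonglongrightarrow> \<bar>C0 - C0\<bar> * E + (R / (R - 1) * (tail_const r p * (1 / log (real r) (1 / kappa r p)) powr (- 3 / 2)) * E) ^ 2 * 0"
      by (intro tendsto_intros t a cm invm)
    then show "(\<lambda>d. \<bar>t d - C0\<bar> * E + (c (m d) * a d * E) ^ 2 * (1 / R) ^ (d - m d)) \<longlonglongrightarrow> 0"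
      by simp
  qed
  \<comment> \<open>Poisson approximation over independent blocks: the error R^(d-m) y^2 is of order
    R^(-(d-m)), because R^(d-m) y stays bounded.\<close>
  have d2: "(\<lambda>d. (1 - y d) ^ (r ^ (d - m d)) - exp (- (R ^ (d - m d) * y d))) \<longlonglongrightarrow> 0"
  proof (rule Lim_null_comparison)
    show "\<forall>\<^sub>F d in sequentially. norm ((1 - y d) ^ (r ^ (d - m d)) - exp (- (R ^ (d - m d) * y d)))
        \<le> (t d * E) ^ 2 * (1 / R) ^ (d - m d)"
      using eE
    proof eventually_elim
      case (elim d)
      have t0: "0 \<le> t d" 
      proof -
        have "0 \<le> t d * e d"
          using Ry_le[of d] y01[of d] R by (meson mult_nonneg_nonneg order_trans zero_le_power zero_le_numeral)
        then show ?thesis using e0[of d] by (simp add: zero_le_mult_iff)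
      qed
      have "norm ((1 - y d) ^ (r ^ (d - m d)) - exp (- (R ^ (d - m d) * y d))) \<le> R ^ (d - m d) * y d ^ 2"
        using power_one_minus_exp[OF y01(1)[of d] y01(2)[of d], of "r ^ (d - m d)"] by (simp add: R_def)
      also have "\<dots> = (R ^ (d - m d) * y d) ^ 2 * (1 / R) ^ (d - m d)"
        using R by (simp add: power_divide power2_eq_square)
      also have "\<dots> \<le> (t d * E) ^ 2 * (1 / R) ^ (d - m d)"
      proof (intro mult_right_mono power_mono)
        show "R ^ (d - m d) * y d \<le> t d * E"
          using Ry_le[of d] mult_left_mono[OF elim t0] by linarith
      qed (use R y01[of d] in auto)
      finally show ?case .
    qed
    have "(\<lambda>d. (t d * E) ^ 2 * (1 / R) ^ (d - m d)) \<longlonglongrightarrow> (C0 * E) ^ 2 * 0"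
      by (intro tendsto_intros t invm)
    then show "(\<lambda>d. (t d * E) ^ 2 * (1 / R) ^ (d - m d)) \<longlonglongrightarrow> 0" by simp
  qed
  \<comment> \<open>The error of ignoring the nodes above the cut, of order R^(d-m) q and thus
    R^(-m).\<close>
  have d3: "(\<lambda>d. P d - (1 - y d) ^ (r ^ (d - m d))) \<longlonglongrightarrow> 0"
  proof (rule Lim_null_comparison)
    show "\<forall>\<^sub>F d in sequentially. norm (P d - (1 - y d) ^ (r ^ (d - m d))) \<le> c (d - m d) * a d * (1 / R) ^ m d * E"
      using eE
    proof eventually_elim
      case (elim d)
      have "P d \<le> (1 - y d) ^ (r ^ (d - m d))"
        unfolding P_def y_def by (rule prob_no_large_le[OF m_le])
      moreover have "(1 - y d) ^ (r ^ (d - m d)) - real (card (tree_upto r (d - m d))) * q d \<le> P d"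
        unfolding P_def y_def q_def by (rule prob_no_large_ge[OF m_le])
      moreover have "real (card (tree_upto r (d - m d))) * q d = c (d - m d) * a d * (1 / R) ^ m d * e d"
        unfolding q_eq c_def using R by (simp add: power_divide mult_ac)
      moreover have "c (d - m d) * a d * (1 / R) ^ m d * e d \<le> c (d - m d) * a d * (1 / R) ^ m d * E"
        using elim R a0[of d] c0 by (intro mult_left_mono) auto
      ultimately show ?case unfolding real_norm_def by linarith
    qed
    have "(\<lambda>d. c (d - m d) * a d * (1 / R) ^ m d * E) \<longlonglongrightarrow>
        R / (R - 1) * (tail_const r p * (1 / log (real r) (1 / kappa r p)) powr (- 3 / 2)) * 0 * E"
      by (intro tendsto_intros a cm invm)
    then show "(\<lambda>d. c (d - m d) * a d * (1 / R) ^ m d * E) \<longlonglongrightarrow> 0" by simp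
  qed
  have d4: "(\<lambda>d. exp (- (R ^ (d - m d) * y d)) - exp (- (C0 * e d))) \<longlonglongrightarrow> 0"
  proof (rule Lim_null_comparison[OF _ tendsto_rabs_zero[OF d1]])
    show "\<forall>\<^sub>F d in sequentially. norm (exp (- (R ^ (d - m d) * y d)) - exp (- (C0 * e d)))
        \<le> \<bar>R ^ (d - m d) * y d - C0 * e d\<bar>"
      using R y01(1) C0 e0 by (intro always_eventually allI) (simp add: abs_exp_minus_diff_le less_imp_le)
  qed
  have "(\<lambda>d. P d - exp (- (C0 * e d))) \<longlonglongrightarrow> 0"
    using tendsto_add[OF tendsto_add[OF d3 d2] d4] by simp
  then show ?thesis
    unfolding P_def C0_def e_def by simp
qed

end

section \<open>Limit laws\<close>

lemma ex_gumbel: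
  fixes C k :: real
  assumes C: "0 < C" and k: "0 < k" "k < 1"
  shows "\<exists>Z. real_distribution Z \<and> (\<forall>z. measure Z {..z} = exp (- C * k powr z))"
proof -
  define l where "l = - ln k"
  have l: "0 < l" using k by (simp add: l_def)
  define F where "F z = exp (- C * k powr z)" for z
  have F: "F = (\<lambda>z. exp (- C * exp (- l * z)))"
    using k by (simp add: F_def[abs_def] l_def powr_def mult.commute)
  have mono: "F x \<le> F y" if "x \<le> y" for x y
    using that C l by (simp add: F)
  have cont: "continuous (at_right a) F" for a
    unfolding F by (intro continuous_intros)
  have bot: "(F \<longlongrightarrow> 0) at_bot" unfolding F using C l by real_asymp
  have top: "(F \<longlongrightarrow> 1) at_top" unfolding F using C l by real_asymp
  show ?thesis
    using real_distribution_interval_measure[OF mono cont bot top]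
      measure_interval_measure_Iic[OF mono cont bot]
    by (intro exI[of _ "interval_measure F"]) (auto simp: F_def)
qed

lemma (in real_distribution) ex_interval_measure_gt:
  assumes "0 < e"
  shows "\<exists>a b. a < b \<and> 1 - e < measure M {a<..b}"
proof -
  have "\<forall>\<^sub>F i in sequentially. cdf M (- real i) < e / 2"
    using order_tendstoD(2)[OF cdf_lim_neg_infty, of "e / 2"] assms by simp
  moreover have "\<forall>\<^sub>F i in sequentially. 1 - e / 2 < cdf M (real i)"
    using order_tendstoD(1)[OF cdf_lim_infty_prob, of "1 - e / 2"] assms by simp
  ultimately have "\<forall>\<^sub>F i in sequentially. - real i < real i \<and> 1 - e < measure M {- real i<..real i}"
    using eventually_gt_at_top[of 0]
  proof eventually_elim
    case (elim i)
    then show ?case using cdf_diff_eq[of "- real i" "real i"] by simp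
  qed
  then show ?thesis
    using eventually_happens'[OF sequentially_bot] by blast
qed

text \<open>Finitely many laws can be treated one by one, so an interval that works eventually is
  widened to one that works always.\<close>

lemma tightI_eventually:
  assumes D: "\<And>n. real_distribution (\<mu> n)"
    and ev: "\<And>e. 0 < e \<Longrightarrow> \<exists>a b. a < b \<and> (\<forall>\<^sub>F n in sequentially. 1 - e < measure (\<mu> n) {a<..b})"
  shows "tight \<mu>"
  unfolding tight_def
proof (intro conjI allI impI D)
  fix e :: real assume e: "0 < e"
  have mono: "1 - e < measure (\<mu> n) {a'<..b'}"
    if "1 - e < measure (\<mu> n) {a<..b}" "a' \<le> a" "b \<le> b'" for n a b a' b'
  proof -
    interpret real_distribution "\<mu> n" by (rule D)
    have "measure (\<mu> n) {a<..b} \<le> measure (\<mu> n) {a'<..b'}"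
      using that by (intro finite_measure_mono) auto
    then show ?thesis using that by linarith
  qed
  obtain a b N where ab: "a < b" "\<And>n. N \<le> n \<Longrightarrow> 1 - e < measure (\<mu> n) {a<..b}"
    using ev[OF e] by (auto simp: eventually_sequentially)
  have "\<exists>a' b'. a' \<le> a \<and> b \<le> b' \<and> (\<forall>n<m. 1 - e < measure (\<mu> n) {a'<..b'})" for m
  proof (induction m)
    case 0
    then show ?case by auto
  next
    case (Suc m)
    then obtain a' b' where 1: "a' \<le> a" "b \<le> b'" "\<And>n. n < m \<Longrightarrow> 1 - e < measure (\<mu> n) {a'<..b'}"
      by blast
    obtain a'' b'' where 2: "1 - e < measure (\<mu> m) {a''<..b''}"
      using real_distribution.ex_interval_measure_gt[OF D e] by blast
    have "1 - e < measure (\<mu> n) {min a' a''<..max b' b''}" if "n < Suc m" for n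
      using that mono[OF 1(3)] mono[OF 2] by (auto simp: less_Suc_eq)
    then show ?case
      using 1(1,2) by (intro exI[of _ "min a' a''"] exI[of _ "max b' b''"]) auto
  qed
  then obtain a' b' where ab': "a' \<le> a" "b \<le> b'" "\<And>n. n < N \<Longrightarrow> 1 - e < measure (\<mu> n) {a'<..b'}"
    by blast
  have "1 - e < measure (\<mu> n) {a'<..b'}" for n
    using ab' mono[OF ab(2)] by (cases "n < N") auto
  then show "\<exists>a b. a < b \<and> (\<forall>n. 1 - e < measure (\<mu> n) {a<..b})"
    using ab(1) ab' by (intro exI[of _ a'] exI[of _ b']) auto
qed

text \<open>The expression is the largest point not above z of the integer lattice shifted by
  -x.\<close>

lemma floor_shift_bounds:
  fixes z x :: real
  shows "z - 1 < of_int \<lfloor>z + x\<rfloor> - x" "of_int \<lfloor>z + x\<rfloor> - x \<le> z"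
  by linarith+

text \<open>The event is Z < [z+a] + 1 - a, and since Z has no atoms the strict inequality may be
  relaxed. The added 1 produces the factor k next to C.\<close>

lemma cdf_lattice_law:
  assumes Z: "real_distribution Z" "\<And>z. measure Z {..z} = exp (- C * k powr z)" and k: "0 < k"
  shows "cdf (lattice_law Z a) z = exp (- (C * k) * k powr (of_int \<lfloor>z + a\<rfloor> - a))"
proof -
  interpret real_distribution Z by fact
  define t where "t = of_int \<lfloor>z + a\<rfloor> - a + 1"
  have cdf: "cdf Z = (\<lambda>z. exp (- C * k powr z))"
    by (simp add: cdf_def Z(2) fun_eq_iff)
  have "isCont (cdf Z) t"
    unfolding cdf using k by (intro continuous_intros) auto
  then have t0: "measure Z {t} = 0"
    by (simp add: isCont_cdf)
  have "cdf (lattice_law Z a) z = measure Z {w. real_of_int \<lfloor>w + a\<rfloor> - a \<le> z}"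
    unfolding cdf_def lattice_law_def by (subst measure_distr) (auto simp: vimage_def)
  also have "{w. real_of_int \<lfloor>w + a\<rfloor> - a \<le> z} = {..<t}"
    by (auto simp: t_def le_floor_iff[symmetric] diff_le_eq) linarith+
  also have "measure Z {..<t} = measure Z {..t}"
  proof -
    have "measure Z ({..<t} \<union> {t}) = measure Z {..<t} + measure Z {t}"
      by (intro finite_measure_Union) auto
    moreover have "{..<t} \<union> {t} = {..t}"
      by auto
    ultimately show ?thesis
      using t0 by simp
  qed
  also have "\<dots> = exp (- (C * k) * k powr (of_int \<lfloor>z + a\<rfloor> - a))"
    using k by (simp add: Z(2) t_def powr_add)
  finally show ?thesis .
qed

lemma real_distribution_lattice_law: "real_distribution Z \<Longrightarrow> real_distribution (lattice_law Z a)"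
proof -
  assume "real_distribution Z"
  then interpret real_distribution Z .
  show ?thesis unfolding lattice_law_def by (intro real_distribution_distr) measurable
qed

text \<open>At a lattice point the distribution function jumps: approached from the left, the floor
  stays one lower, and the two values differ because 0 < k < 1 and C > 0.\<close>

lemma isCont_cdf_lattice_law_imp:
  assumes Z: "real_distribution Z" "\<And>z. measure Z {..z} = exp (- C * k powr z)"
    and k: "0 < k" "k < 1" and C: "0 < C"
    and cont: "isCont (cdf (lattice_law Z a)) z"
  shows "z + a \<notin> \<int>"
proof
  assume "z + a \<in> \<int>"
  then obtain m :: int where m: "z + a = of_int m" by (auto elim: Ints_cases)
  note cdf = cdf_lattice_law[OF Z k(1)]
  define h where "h n = z - inverse (real (Suc n))" for n
  have "h \<longlonglongrightarrow> z - 0"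
    unfolding h_def by (intro tendsto_diff tendsto_const LIMSEQ_inverse_real_of_nat)
  then have "(\<lambda>n. cdf (lattice_law Z a) (h n)) \<longlonglongrightarrow> cdf (lattice_law Z a) z"
    using isCont_tendsto_compose[OF cont] by simp
  moreover have "cdf (lattice_law Z a) (h n) = exp (- (C * k) * k powr (of_int m - 1 - a))" for n
  proof -
    have "0 < inverse (real (Suc n))" "inverse (real (Suc n)) \<le> 1"
      by (auto simp: inverse_le_1_iff)
    moreover have "real_of_int (m - 1) = z + a - 1"
      using m by simp
    ultimately have "\<lfloor>h n + a\<rfloor> = m - 1"
      unfolding h_def by (intro floor_unique) linarith+
    then show ?thesis by (simp add: cdf)
  qed
  ultimately have "cdf (lattice_law Z a) z = exp (- (C * k) * k powr (of_int m - 1 - a))"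
    by (simp add: LIMSEQ_const_iff)
  moreover have "cdf (lattice_law Z a) z = exp (- (C * k) * k powr (of_int m - a))"
    by (simp add: cdf m)
  moreover have "k powr (of_int m - a) < k powr (of_int m - 1 - a)"
    using k by (intro powr_less_mono') auto
  ultimately show False using C k by simp
qed

section \<open>Tightness and weak limits of the centered maximum\<close>

context bernoulli_tree
begin

lemma real_distribution_centered: "real_distribution (centered_law r p M X d)"
  unfolding centered_law_def by (intro real_distribution_distr) measurable

lemma cdf_centered:
  "cdf (centered_law r p M X d) z = prob {\<omega>\<in>space M. real (largest_cluster r X d \<omega>) - mu r p d \<le> z}"
proof -
  have "(\<lambda>\<omega>. real (largest_cluster r X d \<omega>) - mu r p d) \<in> borel_measurable M"
    by measurable
  then show ?thesis
    unfolding cdf_def centered_law_def by (subst measure_distr) (auto intro!: arg_cong[where f = prob])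
qed

lemma mu_at_top: "filterlim (mu r p) at_top sequentially"
proof -
  have "filterlim (\<lambda>d. mu r p d / real d * real d) at_top sequentially"
    by (rule filterlim_tendsto_pos_mult_at_top[OF mu_over_d_tendsto[OF r p] _ filterlim_real_sequentially])
      (use log_inverse_kappa_pos[OF r p] in simp)
  moreover have "\<forall>\<^sub>F d in sequentially. mu r p d / real d * real d = mu r p d"
    using eventually_gt_at_top[of 0] by eventually_elim simp
  ultimately show ?thesis
    by (rule filterlim_cong[OF refl refl, THEN iffD1, rotated])
qed

text \<open>As the maximum is an integer, it exceeds mu_d by at most z iff it is at most [z + mu_d],
  a threshold at bounded distance from mu_d.\<close>

lemma cdf_centered_asymp:
  "(\<lambda>d. cdf (centered_law r p M X d) z
      - exp (- mean_const r p * kappa r p powr (of_int \<lfloor>z + mu r p d\<rfloor> - mu r p d))) \<longlonglongrightarrow> 0"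
proof -
  define N where "N d = nat \<lfloor>z + mu r p d\<rfloor>" for d
  have pos: "\<forall>\<^sub>F d in sequentially. 0 \<le> z + mu r p d"
    using filterlim_at_top[THEN iffD1, rule_format, OF mu_at_top, of "- z"]
    by eventually_elim linarith
  have N: "real (N d) = of_int \<lfloor>z + mu r p d\<rfloor>" if "0 \<le> z + mu r p d" for d
    using that by (simp add: N_def)
  have "\<forall>\<^sub>F d in sequentially. \<bar>real (N d) - mu r p d\<bar> \<le> \<bar>z\<bar> + 1"
    using pos by eventually_elim (use N floor_shift_bounds[of z] in \<open>smt (verit)\<close>)
  from no_large_asymp[OF this] show ?thesis
  proof (rule Lim_transform_eventually)
    show "\<forall>\<^sub>F d in sequentially. prob {\<omega>\<in>space M. \<not> some_large r d (N d) (config \<omega>)}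
        - exp (- mean_const r p * kappa r p powr (real (N d) - mu r p d))
      = cdf (centered_law r p M X d) z
        - exp (- mean_const r p * kappa r p powr (of_int \<lfloor>z + mu r p d\<rfloor> - mu r p d))"
      using pos
    proof eventually_elim
      case (elim d)
      have "real K - mu r p d \<le> z \<longleftrightarrow> K \<le> N d" for K
        using N[OF elim] by linarith
      then show ?case
        unfolding cdf_centered prob_largest_cluster_le[symmetric] N[OF elim] by simp
    qed
  qed
qed

text \<open>Rounding moves the argument by less than one, so the oscillating term lies between two
  values independent of d. This gives tightness and keeps subsequential limits away from 0 and
  1.\<close>

lemma gumbel_term_bounds:
  "exp (- mean_const r p * kappa r p powr (z - 1))
      \<le> exp (- mean_const r p * kappa r p powr (of_int \<lfloor>z + x\<rfloor> - x))"
  "exp (- mean_const r p * kappa r p powr (of_int \<lfloor>z + x\<rfloor> - x))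
      \<le> exp (- mean_const r p * kappa r p powr z)"
proof -
  have "kappa r p powr (of_int \<lfloor>z + x\<rfloor> - x) \<le> kappa r p powr (z - 1)"
    "kappa r p powr z \<le> kappa r p powr (of_int \<lfloor>z + x\<rfloor> - x)"
    using kappa_bounds floor_shift_bounds[of z x] by (auto intro!: powr_mono')
  then show "exp (- mean_const r p * kappa r p powr (z - 1))
      \<le> exp (- mean_const r p * kappa r p powr (of_int \<lfloor>z + x\<rfloor> - x))"
    "exp (- mean_const r p * kappa r p powr (of_int \<lfloor>z + x\<rfloor> - x))
      \<le> exp (- mean_const r p * kappa r p powr z)"
    using mean_const_pos(2)[OF r p] by auto
qed

lemma tight_centered: "tight (\<lambda>n. centered_law r p M X (Suc n))"
proof (rule tightI_eventually[OF real_distribution_centered])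
  fix e :: real assume e: "0 < e"
  let ?F = "\<lambda>z. exp (- mean_const r p * kappa r p powr z)"
  obtain Z where Z: "real_distribution Z" "\<And>z. measure Z {..z} = ?F z"
    using ex_gumbel[OF mean_const_pos(2)[OF r p] kappa_bounds] by blast
  obtain a b where ab: "a < b" "1 - e / 2 < measure Z {a<..b}"
    using real_distribution.ex_interval_measure_gt[OF Z(1), of "e / 2"] e by auto
  interpret Z: real_distribution Z by fact
  have F: "1 - e / 2 < ?F b - ?F a"
    using ab(2) Z.cdf_diff_eq[OF ab(1)] by (simp add: cdf_def Z(2))
  have err: "\<forall>\<^sub>F d in sequentially. \<bar>cdf (centered_law r p M X d) z
      - exp (- mean_const r p * kappa r p powr (of_int \<lfloor>z + mu r p d\<rfloor> - mu r p d))\<bar> < e / 4" for z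
    using order_tendstoD(2)[OF tendsto_rabs_zero[OF cdf_centered_asymp], of "e / 4"] e by simp
  \<comment> \<open>Taking b + 1 compensates the rounding, so that the lower bound is the Gumbel
    value at b. The loss is e/2 from the Gumbel law and e/4 at each endpoint.\<close>
  have "\<forall>\<^sub>F d in sequentially. 1 - e < measure (centered_law r p M X d) {a<..b + 1}"
    using err[of a] err[of "b + 1"]
  proof eventually_elim
    case (elim d)
    interpret K: real_distribution "centered_law r p M X d" by (rule real_distribution_centered)
    have "cdf (centered_law r p M X d) (b + 1) - cdf (centered_law r p M X d) a
        = measure (centered_law r p M X d) {a<..b + 1}"
      using ab(1) by (intro K.cdf_diff_eq) simp
    moreover note gumbel_term_bounds(1)[of "b + 1" "mu r p d", unfolded add_diff_cancel_right']
      gumbel_term_bounds(2)[of a "mu r p d"]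
    ultimately show ?case
      using elim F unfolding abs_less_iff by linarith
  qed
  then show "\<exists>a b. a < b \<and> (\<forall>\<^sub>F n in sequentially. 1 - e < measure (centered_law r p M X (Suc n)) {a<..b})"
    using ab(1) eventually_sequentially_Suc[where P = "\<lambda>d. 1 - e < measure (centered_law r p M X d) {a<..b + 1}"]
    by (intro exI[of _ a] exI[of _ "b + 1"]) simp
qed

lemma cdf_centered_subseq:
  assumes "strict_mono s"
  shows "(\<lambda>k. cdf (centered_law r p M X (s k)) z
      - exp (- mean_const r p * kappa r p powr (of_int \<lfloor>z + mu r p (s k)\<rfloor> - mu r p (s k)))) \<longlonglongrightarrow> 0"
  using LIMSEQ_subseq_LIMSEQ[OF cdf_centered_asymp assms] by (simp add: o_def)

lemma weak_conv_centered:
  assumes s: "strict_mono s"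
    and a: "tendsto_mod1 (\<lambda>k. mu r p (s k) - of_int \<lfloor>mu r p (s k)\<rfloor>) a"
    and Z: "real_distribution Z" "\<And>z. measure Z {..z} = exp (- (mean_const r p / kappa r p) * kappa r p powr z)"
  shows "weak_conv_m (\<lambda>k. centered_law r p M X (s k)) (lattice_law Z a)"
  unfolding weak_conv_m_def weak_conv_def
proof (intro allI impI)
  fix z assume cont: "isCont (cdf (lattice_law Z a)) z"
  have C: "0 < mean_const r p / kappa r p"
    using mean_const_pos(2)[OF r p] kappa_bounds by simp
  have nonint: "z + a \<notin> \<int>"
    by (rule isCont_cdf_lattice_law_imp[OF Z kappa_bounds C cont])
  have lim: "cdf (lattice_law Z a) z = exp (- mean_const r p * kappa r p powr (of_int \<lfloor>z + a\<rfloor> - a))"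
    using cdf_lattice_law[OF Z kappa_bounds(1), of a z] kappa_bounds by simp
  \<comment> \<open>Modulo integers, mu_(s k) is a + \<delta>_k with \<delta>_k tending to 0.
    Shifting by an integer does not change the lattice.\<close>
  define f where "f k = mu r p (s k) - of_int \<lfloor>mu r p (s k)\<rfloor> - a" for k
  define \<delta> where "\<delta> k = f k - of_int (round (f k))" for k
  have \<delta>: "\<delta> \<longlonglongrightarrow> 0"
    using a unfolding tendsto_mod1_def \<delta>_def f_def by (rule tendsto_rabs_zero_cancel)
  have "(\<lambda>k. z + a + \<delta> k) \<longlonglongrightarrow> z + a + 0"
    by (intro tendsto_add tendsto_const \<delta>)
  \<comment> \<open>The floor is locally constant at z + a, which is not an integer at a continuity
    point.\<close>
  then have fl: "\<forall>\<^sub>F k in sequentially. \<lfloor>z + a + \<delta> k\<rfloor> = \<lfloor>z + a\<rfloor>"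
    using nonint by (intro eventually_floor_eq) auto
  have rel: "of_int \<lfloor>z + a + \<delta> k\<rfloor> - a - \<delta> k = of_int \<lfloor>z + mu r p (s k)\<rfloor> - mu r p (s k)" for k
  proof -
    have "z + mu r p (s k) = (z + a + \<delta> k) + of_int (\<lfloor>mu r p (s k)\<rfloor> + round (f k))"
      by (simp add: \<delta>_def f_def)
    show ?thesis
      unfolding \<open>z + mu r p (s k) = _\<close> floor_add_int[symmetric] by (simp add: \<delta>_def f_def)
  qed
  have ev: "\<forall>\<^sub>F k in sequentially. of_int \<lfloor>z + a\<rfloor> - a - \<delta> k = of_int \<lfloor>z + mu r p (s k)\<rfloor> - mu r p (s k)"
    using fl by eventually_elim (simp flip: rel)
  have "(\<lambda>k. exp (- mean_const r p * kappa r p powr (of_int \<lfloor>z + a\<rfloor> - a - \<delta> k)))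
      \<longlonglongrightarrow> exp (- mean_const r p * kappa r p powr (of_int \<lfloor>z + a\<rfloor> - a - 0))"
    using kappa_bounds by (intro tendsto_exp tendsto_mult tendsto_powr tendsto_diff tendsto_const \<delta>) auto
  moreover have "\<forall>\<^sub>F k in sequentially. exp (- mean_const r p * kappa r p powr (of_int \<lfloor>z + a\<rfloor> - a - \<delta> k))
      = exp (- mean_const r p * kappa r p powr (of_int \<lfloor>z + mu r p (s k)\<rfloor> - mu r p (s k)))"
    using ev by eventually_elim simp
  ultimately have "(\<lambda>k. exp (- mean_const r p * kappa r p powr (of_int \<lfloor>z + mu r p (s k)\<rfloor> - mu r p (s k))))
      \<longlonglongrightarrow> cdf (lattice_law Z a) z"
    unfolding lim using Lim_transform_eventually by fastforce
  from tendsto_add[OF cdf_centered_subseq[OF s, of z] this]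
  show "(\<lambda>k. cdf (centered_law r p M X (s k)) z) \<longlonglongrightarrow> cdf (lattice_law Z a) z"
    by simp
qed

text \<open>The limiting value of the distribution functions at z can be solved for the lattice
  point just below z, which is congruent to -mu_(s k) modulo 1.\<close>

lemma tendsto_mod1_of_weak_conv:
  assumes s: "strict_mono s" and \<nu>: "real_distribution \<nu>"
    and conv: "weak_conv_m (\<lambda>k. centered_law r p M X (s k)) \<nu>"
  shows "\<exists>a. tendsto_mod1 (\<lambda>k. mu r p (s k) - of_int \<lfloor>mu r p (s k)\<rfloor>) a"
proof -
  interpret \<nu>: real_distribution \<nu> by fact
  let ?k = "kappa r p" and ?C = "mean_const r p"
  have C: "0 < ?C" using mean_const_pos(2)[OF r p] .
  have lk: "ln ?k \<noteq> 0" using kappa_bounds by simp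
  \<comment> \<open>A law has only countably many atoms.\<close>
  obtain z where "measure \<nu> {z} = 0"
  proof -
    have "{x. 0 < measure \<nu> {x}} \<noteq> UNIV"
      using \<nu>.countable_atoms uncountable_UNIV_real by metis
    then show ?thesis using that by (metis (mono_tags, lifting) UNIV_eq_I mem_Collect_eq zero_less_measure_iff)
  qed
  then have "isCont (cdf \<nu>) z" by (simp add: \<nu>.isCont_cdf)
  then have cdf_lim: "(\<lambda>k. cdf (centered_law r p M X (s k)) z) \<longlonglongrightarrow> cdf \<nu> z"
    using conv by (simp add: weak_conv_m_def weak_conv_def)
  define b where "b k = of_int \<lfloor>z + mu r p (s k)\<rfloor> - mu r p (s k)" for k
  define F where "F = cdf \<nu> z"
  have lim: "(\<lambda>k. exp (- ?C * ?k powr b k)) \<longlonglongrightarrow> F"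
    using tendsto_diff[OF cdf_lim cdf_centered_subseq[OF s, of z]] by (simp add: b_def F_def)
  \<comment> \<open>A limit strictly between 0 and 1 is what allows the logarithm to be taken
    twice.\<close>
  have "exp (- ?C * ?k powr (z - 1)) \<le> F"
    by (rule LIMSEQ_le_const[OF lim]) (use gumbel_term_bounds(1)[of z] in \<open>auto simp: b_def\<close>)
  then have F0: "0 < F"
    using exp_gt_zero less_le_trans by blast
  have "F \<le> exp (- ?C * ?k powr z)"
    by (rule LIMSEQ_le_const2[OF lim]) (use gumbel_term_bounds(2)[of z] in \<open>auto simp: b_def\<close>)
  also have "\<dots> < 1"
    using C kappa_bounds by simp
  finally have F1: "F < 1" .
  have "(\<lambda>k. ln (exp (- ?C * ?k powr b k))) \<longlonglongrightarrow> ln F"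
    using F0 by (intro tendsto_ln lim) auto
  then have "(\<lambda>k. ln (exp (- ?C * ?k powr b k)) / (- ?C)) \<longlonglongrightarrow> ln F / (- ?C)"
    using C by (intro tendsto_divide tendsto_const) auto
  then have "(\<lambda>k. ?k powr b k) \<longlonglongrightarrow> ln F / (- ?C)"
    using C by simp
  moreover have w: "0 < ln F / (- ?C)"
    using F0 F1 C by (simp add: divide_neg_pos)
  ultimately have "(\<lambda>k. ln (?k powr b k) / ln ?k) \<longlonglongrightarrow> ln (ln F / (- ?C)) / ln ?k"
    using lk by (intro tendsto_divide tendsto_ln tendsto_const) auto
  then have b: "b \<longlonglongrightarrow> ln (ln F / (- ?C)) / ln ?k"
    using lk kappa_bounds by (simp add: ln_powr)
  \<comment> \<open>The offsets from the lattice converge by one continuity point of the limit law alone.\<close>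
  define \<beta> where "\<beta> = ln (ln F / (- ?C)) / ln ?k"
  have "tendsto_mod1 (\<lambda>k. mu r p (s k) - of_int \<lfloor>mu r p (s k)\<rfloor>) (- \<beta>)"
    unfolding tendsto_mod1_def
  proof (rule Lim_null_comparison)
    show "\<forall>\<^sub>F k in sequentially. norm \<bar>mu r p (s k) - of_int \<lfloor>mu r p (s k)\<rfloor> - - \<beta>
        - of_int (round (mu r p (s k) - of_int \<lfloor>mu r p (s k)\<rfloor> - - \<beta>))\<bar> \<le> \<bar>b k - \<beta>\<bar>"
    proof (intro always_eventually allI)
      fix k
      \<comment> \<open>Rounding is the best integer approximation, hence no worse than the integer
        under which the error is exactly |b_k - \<beta>|.\<close>
      have "\<bar>x - of_int (round x)\<bar> \<le> \<bar>x - of_int m\<bar>" for x :: real and m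
        by (rule round_diff_minimal)
      from this[of "mu r p (s k) - of_int \<lfloor>mu r p (s k)\<rfloor> - - \<beta>" "\<lfloor>z + mu r p (s k)\<rfloor> - \<lfloor>mu r p (s k)\<rfloor>"]
      show "norm \<bar>mu r p (s k) - of_int \<lfloor>mu r p (s k)\<rfloor> - - \<beta>
        - of_int (round (mu r p (s k) - of_int \<lfloor>mu r p (s k)\<rfloor> - - \<beta>))\<bar> \<le> \<bar>b k - \<beta>\<bar>"
        by (simp add: b_def abs_minus_commute algebra_simps)
    qed
    show "(\<lambda>k. \<bar>b k - \<beta>\<bar>) \<longlonglongrightarrow> 0"
      using b unfolding \<beta>_def[symmetric] by (intro tendsto_rabs_zero LIM_zero)
  qed
  then show ?thesis ..
qed

section \<open>Almost sure growth rate\<close>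

lemma large_prob_le_geometric: "\<exists>K>0. \<forall>n. large_prob r p n \<le> K * kappa r p ^ n"
proof -
  obtain K where K: "\<And>n. norm (large_prob r p n / (real n powr (- 3 / 2) * kappa r p ^ n)) \<le> K"
    using convergent_imp_Bseq[OF convergentI[OF large_prob_asymp]] by (meson BseqE)
  \<comment> \<open>The maximum with 1 covers n = 0, where the normalising quotient is 0 by
    convention and carries no information.\<close>
  have "large_prob r p n \<le> max K 1 * kappa r p ^ n" for n
  proof (cases "n = 0")
    case True
    then show ?thesis using large_prob_bounds(2)[of 0] by simp
  next
    case False
    then have pos: "0 < real n powr (- 3 / 2)" by simp
    have "large_prob r p n / (real n powr (- 3 / 2) * kappa r p ^ n) \<le> K"
      using K[of n] unfolding real_norm_def by (rule order_trans[OF abs_ge_self])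
    then have "large_prob r p n \<le> K * (real n powr (- 3 / 2) * kappa r p ^ n)"
      using pos kappa_bounds by (simp add: pos_divide_le_eq)
    also have "\<dots> \<le> max K 1 * (1 * kappa r p ^ n)"
    proof (intro mult_mono)
      have "real n powr (- 3 / 2) \<le> real n powr 0"
        using False by (intro powr_mono) auto
      then show "real n powr (- 3 / 2) \<le> 1" using False by simp
    qed (use kappa_bounds in auto)
    finally show ?thesis by simp
  qed
  then show ?thesis by (intro exI[of _ "max K 1"]) auto
qed

lemma top_mean_le: "0 \<le> top_mean d" "top_mean d \<le> 2 * real r ^ d"
proof -
  have "1 \<le> card (tree_upto r d)"
    using finite_tree_upto[of r d]
    by (auto simp: Suc_le_eq card_gt_0_iff tree_upto_eq intro!: exI[of _ "[]"])
  then have c: "1 \<le> real (card (tree_upto r d))" by simp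
  then show "0 \<le> top_mean d"
    using p_less_1 by (simp add: top_mean_def)
  have "top_mean d \<le> 1 + 1 * (real (card (tree_upto r d)) - 1)"
    unfolding top_mean_def using c p by (intro add_left_mono mult_right_mono) auto
  also have "\<dots> = (real r ^ Suc d - 1) / (real r - 1)"
    by (simp add: card_tree_upto_real)
  also have "\<dots> \<le> 2 * real r ^ d"
  proof -
    have "2 * real r ^ d \<le> real r * real r ^ d"
      using r by (intro mult_right_mono) auto
    then have "real r ^ Suc d - 1 \<le> 2 * real r ^ d * (real r - 1)"
      by (simp add: algebra_simps)
    then show ?thesis using r by (simp add: pos_divide_le_eq)
  qed
  finally show "top_mean d \<le> 2 * real r ^ d" .
qed

definition speed :: real where
  "speed = 1 / log (real r) (1 / kappa r p)"

lemma speed_pos: "0 < speed"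
  using log_inverse_kappa_pos[OF r p] by (simp add: speed_def)

text \<open>The defining balance of the growth rate: kappa^(speed d) cancels the number r^d of
  nodes.\<close>

lemma kappa_powr_speed: "kappa r p powr speed = 1 / real r"
proof -
  have "ln (real r) > 0" using r by simp
  moreover have "ln (kappa r p) < 0" using kappa_bounds by simp
  ultimately have "speed * ln (kappa r p) = - ln (real r)"
    using kappa_bounds by (simp add: speed_def log_def ln_div)
  then show ?thesis
    using kappa_bounds r by (simp add: powr_def exp_minus inverse_eq_divide)
qed

lemma kappa_powr_speed_mult:
  "kappa r p powr ((speed + x) * real d) = (kappa r p powr x) ^ d / real r ^ d"
proof -
  have "kappa r p powr ((speed + x) * real d) = (kappa r p powr (speed + x)) powr real d"
    by (simp add: powr_powr)
  also have "\<dots> = (kappa r p powr x / real r) ^ d"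
    using kappa_bounds r by (simp add: powr_add kappa_powr_speed powr_realpow)
  finally show ?thesis by (simp add: power_divide)
qed

lemma kappa_powr_less_1:
  assumes "0 < x"
  shows "kappa r p powr x < 1"
proof -
  have "kappa r p powr x < kappa r p powr 0"
    using assms kappa_bounds by (intro powr_less_mono') auto
  then show ?thesis using kappa_bounds by simp
qed

text \<open>First moment: beyond (speed + e)d the expected number of good nodes is at most a
  constant times kappa^(ed), which is summable. Rounding the threshold costs the factor
  1/kappa.\<close>

lemma AE_largest_cluster_upper:
  assumes e: "0 < e"
  shows "AE \<omega> in M. \<forall>\<^sub>F d in sequentially. real (largest_cluster r X d \<omega>) \<le> (speed + e) * real d"
proof -
  define N where "N d = nat \<lfloor>(speed + e) * real d\<rfloor>" for d
  define A where "A d = {\<omega>\<in>space M. \<not> largest_cluster r X d \<omega> \<le> N d}" for d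
  have A_meas: "A d \<in> events" for d
    unfolding A_def by measurable
  obtain K where K: "0 < K" "\<And>n. large_prob r p n \<le> K * kappa r p ^ n"
    using large_prob_le_geometric by blast
  have N: "(speed + e) * real d - 1 \<le> real (N d)" "real (N d) \<le> (speed + e) * real d" for d
    using speed_pos e by (auto simp: N_def)
  have prob_A: "prob (A d) \<le> 2 * K / kappa r p * (kappa r p powr e) ^ d" for d
  proof -
    have "prob (A d) = 1 - prob {\<omega>\<in>space M. largest_cluster r X d \<omega> \<le> N d}"
      unfolding A_def by (rule prob_neg) measurable
    also have "\<dots> = 1 - prob {\<omega>\<in>space M. \<not> some_large r d (N d) (config \<omega>)}"
      by (simp only: prob_largest_cluster_le)
    also have "\<dots> = prob {\<omega>\<in>space M. some_large r d (N d) (config \<omega>)}"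
      by (subst prob_neg) auto
    also have "\<dots> \<le> top_mean d * large_prob r p (N d)"
      by (rule prob_some_large_le)
    also have "\<dots> \<le> (2 * real r ^ d) * (K * kappa r p ^ N d)"
      using top_mean_le K large_prob_bounds(1) by (intro mult_mono) auto
    also have "kappa r p ^ N d \<le> kappa r p powr ((speed + e) * real d - 1)"
      using kappa_bounds N(1)[of d] by (simp add: powr_realpow[symmetric] powr_mono')
    also have "kappa r p powr ((speed + e) * real d - 1) = (kappa r p powr e) ^ d / real r ^ d / kappa r p"
      using kappa_bounds by (simp add: powr_diff kappa_powr_speed_mult)
    finally show ?thesis
      using r K by simp
  qed
  have "summable (\<lambda>d. prob (A d))"
  proof (rule summable_comparison_test')
    have "kappa r p powr e < 1"
      using e by (rule kappa_powr_less_1)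
    then show "summable (\<lambda>d. 2 * K / kappa r p * (kappa r p powr e) ^ d)"
      by (intro summable_mult summable_geometric) simp
    show "norm (prob (A d)) \<le> 2 * K / kappa r p * (kappa r p powr e) ^ d" for d
      using prob_A by simp
  qed
  then have "AE \<omega> in M. \<forall>\<^sub>F d in sequentially. \<omega> \<in> space M - A d"
    by (intro borel_cantelli_AE1 A_meas) (auto simp: emeasure_eq_measure)
  then show ?thesis
  proof eventually_elim
    case (elim \<omega>)
    then show ?case
    proof eventually_elim
      case (elim d)
      then have "largest_cluster r X d \<omega> \<le> N d"
        by (auto simp: A_def)
      then show ?case using N(2)[of d] by linarith
    qed
  qed
qed

lemma large_prob_ge: "\<exists>c>0. \<forall>\<^sub>F n in sequentially. c * (real n powr (- 3 / 2) * kappa r p ^ n) \<le> large_prob r p n"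
proof (intro exI conjI)
  show "0 < tail_const r p / 2"
    using mean_const_pos(1)[OF r p] by simp
  have "\<forall>\<^sub>F n in sequentially. tail_const r p / 2 < large_prob r p n / (real n powr (- 3 / 2) * kappa r p ^ n)"
    using order_tendstoD(1)[OF large_prob_asymp, of "tail_const r p / 2"] mean_const_pos(1)[OF r p] by simp
  then show "\<forall>\<^sub>F n in sequentially. tail_const r p / 2 * (real n powr (- 3 / 2) * kappa r p ^ n) \<le> large_prob r p n"
    using eventually_gt_at_top[of 0]
  proof eventually_elim
    case (elim n)
    then have "0 < real n powr (- 3 / 2) * kappa r p ^ n"
      using kappa_bounds by simp
    then show ?case using elim(1) by (simp add: pos_less_divide_eq)
  qed
qed

text \<open>The r^d nodes of generation d are independent trials with expected number of successes
  at least d^(-3/2) kappa^(-ed) up to a constant. The failure probability is so small that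
  Borel--Cantelli applies along all d directly.\<close>

lemma AE_largest_cluster_lower:
  assumes e: "0 < e" "e < speed"
  shows "AE \<omega> in M. \<forall>\<^sub>F d in sequentially. (speed - e) * real d < real (largest_cluster r X d \<omega>)"
proof -
  define N where "N d = nat \<lfloor>(speed - e) * real d\<rfloor>" for d
  define A where "A d = {\<omega>\<in>space M. largest_cluster r X d \<omega> \<le> N d}" for d
  have A_meas: "A d \<in> events" for d
    unfolding A_def by measurable
  have N: "(speed - e) * real d < real (N d) + 1" "real (N d) \<le> (speed - e) * real d" for d
    using e by (auto simp: N_def)
  have N_top: "filterlim N at_top sequentially"
  proof -
    have "filterlim (\<lambda>d. (speed - e) * real d - 1) at_top sequentially"
      using e by real_asymp
    then have "filterlim (\<lambda>d. real (N d)) at_top sequentially"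
      by (rule filterlim_at_top_mono) (use N(1) in \<open>force intro: always_eventually less_imp_le simp: diff_le_eq\<close>)
    then show ?thesis
      by (simp add: filterlim_sequentially_iff_filterlim_real)
  qed
  define B where "B = kappa r p powr (- e)"
  have B: "1 < B"
    using kappa_bounds kappa_powr_less_1[OF e(1)] by (simp add: B_def powr_minus one_less_inverse_iff)
  obtain c where c: "0 < c" "\<forall>\<^sub>F n in sequentially. c * (real n powr (- 3 / 2) * kappa r p ^ n) \<le> large_prob r p n"
    using large_prob_ge by blast
  define c' where "c' = c * speed powr (- 3 / 2)"
  have c': "0 < c'" using c speed_pos by (simp add: c'_def)
  have prob_A: "\<forall>\<^sub>F d in sequentially. prob (A d) \<le> exp (- (c' * real d powr (- 3 / 2) * B ^ d))"
    using filterlim_iff[THEN iffD1, rule_format, OF N_top c(2)]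
      filterlim_at_top[THEN iffD1, rule_format, OF N_top, of 1] eventually_gt_at_top[of 0]
  proof eventually_elim
    case (elim d)
    let ?q = "large_prob r p (N d)"
    \<comment> \<open>Blocks of depth 0 are single nodes of generation d, so the block estimate
      applies with m = 0.\<close>
    have root: "some_large r 0 n x \<longleftrightarrow> large n x" for n x
      by (auto simp: some_large_def tree_upto_eq)
    have "prob (A d) \<le> (1 - ?q) ^ (r ^ d)"
      using prob_no_large_le[of 0 d "N d"] unfolding A_def prob_largest_cluster_le root prob_large by simp
    also have "\<dots> \<le> exp (- ?q) ^ (r ^ d)"
      using large_prob_bounds(2) exp_ge_add_one_self[of "- ?q"] by (intro power_mono) auto
    also have "\<dots> = exp (- (real r ^ d * ?q))"
      by (simp add: exp_of_nat_mult[symmetric])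
    also have "\<dots> \<le> exp (- (c' * real d powr (- 3 / 2) * B ^ d))"
    proof -
      have "(speed * real d) powr (- 3 / 2) \<le> real (N d) powr (- 3 / 2)"
      proof (rule powr_mono2')
        have "(speed - e) * real d \<le> speed * real d"
          using e by (intro mult_right_mono) auto
        then show "real (N d) \<le> speed * real d"
          using N(2)[of d] by linarith
      qed (use elim in auto)
      moreover have "B ^ d / real r ^ d \<le> kappa r p ^ N d"
      proof -
        have "kappa r p powr ((speed + - e) * real d) \<le> kappa r p powr real (N d)"
          using kappa_bounds N(2)[of d] by (intro powr_mono') auto
        then show ?thesis
          using kappa_bounds unfolding kappa_powr_speed_mult by (simp add: B_def powr_realpow)
      qed
      ultimately have "c * ((speed * real d) powr (- 3 / 2) * (B ^ d / real r ^ d)) \<le> ?q"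
        using c(1) B elim(1) kappa_bounds
        by (intro order_trans[OF _ elim(1)] mult_left_mono mult_mono) auto
      then have "real r ^ d * (c * ((speed * real d) powr (- 3 / 2) * (B ^ d / real r ^ d))) \<le> real r ^ d * ?q"
        by (intro mult_left_mono) auto
      moreover have "real r ^ d * (c * ((speed * real d) powr (- 3 / 2) * (B ^ d / real r ^ d)))
          = c' * real d powr (- 3 / 2) * B ^ d"
        using r speed_pos by (simp add: c'_def powr_mult)
      ultimately show ?thesis by simp
    qed
    finally show ?case .
  qed
  have "summable (\<lambda>d. prob (A d))"
  proof (rule summable_comparison_test_ev)
    show "\<forall>\<^sub>F d in sequentially. norm (prob (A d)) \<le> exp (- (c' * real d powr (- 3 / 2) * B ^ d))"
      using prob_A by simp
    show "summable (\<lambda>d. exp (- (c' * real d powr (- 3 / 2) * B ^ d)))"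
    proof (rule summable_comparison_test_bigo)
      show "summable (\<lambda>n. norm (1 / real n ^ 2))"
        using inverse_power_summable[of 2, where ?'a = real] by (simp add: field_simps)
      show "(\<lambda>d. exp (- (c' * real d powr (- 3 / 2) * B ^ d))) \<in> O(\<lambda>n. 1 / real n ^ 2)"
        using c' B by real_asymp
    qed
  qed
  then have "AE \<omega> in M. \<forall>\<^sub>F d in sequentially. \<omega> \<in> space M - A d"
    by (intro borel_cantelli_AE1 A_meas) (auto simp: emeasure_eq_measure)
  then show ?thesis
  proof eventually_elim
    case (elim \<omega>)
    then show ?case
    proof eventually_elim
      case (elim d)
      then have "N d < largest_cluster r X d \<omega>"
        by (auto simp: A_def)
      then show ?case using N(1)[of d] by linarith
    qed
  qed
qed

lemma AE_largest_cluster_speed: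
  "AE \<omega> in M. (\<lambda>d. real (largest_cluster r X d \<omega>) / real d) \<longlonglongrightarrow> speed"
proof -
  \<comment> \<open>Countably many tolerances suffice for one common null set; the 2 keeps each
    below \<open>speed\<close>, as the lower bound demands.\<close>
  define e where "e j = speed / (real j + 2)" for j :: nat
  have e: "0 < e j" "e j < speed" for j
    using speed_pos by (auto simp: e_def divide_less_eq)
  have e_lim: "e \<longlonglongrightarrow> 0"
    unfolding e_def by real_asymp
  have "AE \<omega> in M. \<forall>j. (\<forall>\<^sub>F d in sequentially. real (largest_cluster r X d \<omega>) \<le> (speed + e j) * real d)
      \<and> (\<forall>\<^sub>F d in sequentially. (speed - e j) * real d < real (largest_cluster r X d \<omega>))"
    unfolding AE_all_countable
    using AE_largest_cluster_upper[OF e(1)] AE_largest_cluster_lower[OF e] by (auto intro: AE_conjI)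
  then show ?thesis
  proof eventually_elim
    case (elim \<omega>)
    show ?case
    proof (rule LIMSEQ_I)
      fix \<delta> :: real assume "0 < \<delta>"
      then obtain j where j: "e j < \<delta>"
        using order_tendstoD(2)[OF e_lim, of \<delta>] eventually_happens'[OF sequentially_bot] by blast
      have "\<forall>\<^sub>F d in sequentially. norm (real (largest_cluster r X d \<omega>) / real d - speed) < \<delta>"
        using elim[THEN spec, of j, THEN conjunct1] elim[THEN spec, of j, THEN conjunct2]
          eventually_gt_at_top[of 0]
      proof eventually_elim
        case (elim d)
        then have "real (largest_cluster r X d \<omega>) / real d \<le> speed + e j"
          "speed - e j < real (largest_cluster r X d \<omega>) / real d"
          by (simp_all add: pos_divide_le_eq pos_less_divide_eq)
        then show ?case using j by (simp add: abs_less_iff)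
      qed
      then show "\<exists>no. \<forall>n\<ge>no. norm (real (largest_cluster r X n \<omega>) / real n - speed) < \<delta>"
        by (simp add: eventually_sequentially)
    qed
  qed
qed

end

theorem theorem2:
  fixes r :: nat and p :: real
  assumes "2 \<le> r" and "0 < p" and "p < 1 / real r"
  shows "kappa r p < 1 \<and>
    (\<exists>C > 0. \<exists>Z :: real measure.
       real_distribution Z \<and> (\<forall>z. measure Z {..z} = exp (- C * kappa r p powr z)) \<and>
       (\<forall>(M :: 'a measure) X. iid_bernoulli_tree r p M X \<longrightarrow>
          (AE \<omega> in M. (\<lambda>d. real (largest_cluster r X d \<omega>) / real d)
                         \<longlonglongrightarrow> 1 / log (real r) (1 / kappa r p)) \<and>
          tight (\<lambda>n. centered_law r p M X (Suc n)) \<and>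
          (\<forall>s :: nat \<Rightarrow> nat. strict_mono s \<and> (\<forall>k. 1 \<le> s k) \<longrightarrow>
             ((\<exists>\<nu>. real_distribution \<nu> \<and> weak_conv_m (\<lambda>k. centered_law r p M X (s k)) \<nu>)
                \<longleftrightarrow> (\<exists>a. tendsto_mod1 (\<lambda>k. mu r p (s k) - of_int \<lfloor>mu r p (s k)\<rfloor>) a)) \<and>
             (\<forall>a. tendsto_mod1 (\<lambda>k. mu r p (s k) - of_int \<lfloor>mu r p (s k)\<rfloor>) a \<longrightarrow>
                weak_conv_m (\<lambda>k. centered_law r p M X (s k)) (lattice_law Z a)))))"
proof (intro conjI)
  show "kappa r p < 1"
    using kappa_less_1 assms by blast
  have k: "0 < kappa r p"
    using kappa_pos less_inverse_of_nat_imp_less_1 assms by blast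
  have C: "0 < mean_const r p / kappa r p"
    using mean_const_pos(2)[OF assms] k by simp
  \<comment> \<open>Both the constant and Z are fixed before M and X enter, so they depend on r and
    p only. Division by kappa offsets the factor gained in \<open>cdf_lattice_law\<close>.\<close>
  obtain Z where Z: "real_distribution Z"
    "\<And>z. measure Z {..z} = exp (- (mean_const r p / kappa r p) * kappa r p powr z)"
    using ex_gumbel[OF C k \<open>kappa r p < 1\<close>] by blast
  have main: "(AE \<omega> in M. (\<lambda>d. real (largest_cluster r X d \<omega>) / real d)
                         \<longlonglongrightarrow> 1 / log (real r) (1 / kappa r p)) \<and>
      tight (\<lambda>n. centered_law r p M X (Suc n)) \<and>
      (\<forall>s :: nat \<Rightarrow> nat. strict_mono s \<and> (\<forall>k. 1 \<le> s k) \<longrightarrow>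
         ((\<exists>\<nu>. real_distribution \<nu> \<and> weak_conv_m (\<lambda>k. centered_law r p M X (s k)) \<nu>)
            \<longleftrightarrow> (\<exists>a. tendsto_mod1 (\<lambda>k. mu r p (s k) - of_int \<lfloor>mu r p (s k)\<rfloor>) a)) \<and>
         (\<forall>a. tendsto_mod1 (\<lambda>k. mu r p (s k) - of_int \<lfloor>mu r p (s k)\<rfloor>) a \<longrightarrow>
            weak_conv_m (\<lambda>k. centered_law r p M X (s k)) (lattice_law Z a)))"
    if iid: "iid_bernoulli_tree r p M X" for M :: "'a measure" and X
  proof -
    interpret prob_space M
      using iid by (simp add: iid_bernoulli_tree_def)
    interpret bernoulli_tree M r p X
      using assms iid by unfold_locales
    show ?thesis
      using AE_largest_cluster_speed[unfolded speed_def] tight_centered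
        weak_conv_centered[OF _ _ Z] tendsto_mod1_of_weak_conv real_distribution_lattice_law[OF Z(1)]
      by blast
  qed
  show "\<exists>C > 0. \<exists>Z :: real measure.
       real_distribution Z \<and> (\<forall>z. measure Z {..z} = exp (- C * kappa r p powr z)) \<and>
       (\<forall>(M :: 'a measure) X. iid_bernoulli_tree r p M X \<longrightarrow>
          (AE \<omega> in M. (\<lambda>d. real (largest_cluster r X d \<omega>) / real d)
                         \<longlonglongrightarrow> 1 / log (real r) (1 / kappa r p)) \<and>
          tight (\<lambda>n. centered_law r p M X (Suc n)) \<and>
          (\<forall>s :: nat \<Rightarrow> nat. strict_mono s \<and> (\<forall>k. 1 \<le> s k) \<longrightarrow>
             ((\<exists>\<nu>. real_distribution \<nu> \<and> weak_conv_m (\<lambda>k. centered_law r p M X (s k)) \<nu>)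
                \<longleftrightarrow> (\<exists>a. tendsto_mod1 (\<lambda>k. mu r p (s k) - of_int \<lfloor>mu r p (s k)\<rfloor>) a)) \<and>
             (\<forall>a. tendsto_mod1 (\<lambda>k. mu r p (s k) - of_int \<lfloor>mu r p (s k)\<rfloor>) a \<longrightarrow>
                weak_conv_m (\<lambda>k. centered_law r p M X (s k)) (lattice_law Z a))))"
    using C Z main by (intro exI[of _ "mean_const r p / kappa r p"] conjI exI[of _ Z]) blast+
qed

end
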